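(* Let $n\ge 2$ be an integer, let $\mathcal{A}$ be a unital algebra over a commutative unital ring $\mathcal{R}$ with a nontrivial idempotent $e$, and put $f=1-e$. Suppose that $\mathcal{A}$ is $2$- and $(n-1)$-torsion free, and that for each $x\in\mathcal{A}$: $exe\cdot e\mathcal{A}f=\{0\}=f\mathcal{A}e\cdot exe$ implies $exe=0$, and $e\mathcal{A}f\cdot fxf=\{0\}=fxf\cdot f\mathcal{A}e$ implies $fxf=0$. Let $\varphi$ be a Lie $n$-derivation on $\mathcal{A}$. If (i) $f\varphi(e\mathcal{A}e)f\subseteq f\mathcal{Z}(\mathcal{A})f$ and $e\varphi(f\mathcal{A}f)e\subseteq e\mathcal{Z}(\mathcal{A})e$, and (ii) $e\mathcal{A}e$ or $f\mathcal{A}f$ has no nonzero central ideal, then $\varphi$ is of the form $\varphi=d+\delta+\gamma$, where $d$ is a derivation on $\mathcal{A}$, $\delta$ is a singular Jordan derivation and antiderivation on $\mathcal{A}$, and $\gamma$ is a linear mapping from $\mathcal{A}$ into $\mathcal{Z}(\mathcal{A})$ vanishing on all $(n-1)$-th commutators of $\mathcal{A}$.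
   Context: Linear means $\mathcal{R}$-linear; $\mathcal{Z}(\cdot)$ is the centre. Nontrivial idempotent: $e^2=e$, $e\ne 0,1$. For a positive integer $k$, $\mathcal{A}$ is $k$-torsion free if $kx=0$ implies $x=0$ for each $x\in\mathcal{A}$. $[x,y]=xy-yx$, $x\circ y=xy+yx$. Define $p_1(x_1)=x_1$ and $p_n(x_1,\dots,x_n)=[p_{n-1}(x_1,\dots,x_{n-1}),x_n]$ for $n\ge2$; for $n\ge 2$, $p_n(x_1,\dots,x_n)$ is called an $(n-1)$-th commutator. A linear map $\varphi:\mathcal{A}\to\mathcal{A}$ is a Lie $n$-derivation if $\varphi(p_n(x_1,\dots,x_n))=\sum_{i=1}^n p_n(x_1,\dots,x_{i-1},\varphi(x_i),x_{i+1},\dots,x_n)$ for all $x_1,\dots,x_n\in\mathcal{A}$. A linear map $\delta:\mathcal{A}\to\mathcal{A}$ is a derivation if $\delta(xy)=\delta(x)y+x\delta(y)$, an antiderivation if $\delta(xy)=\delta(y)x+y\delta(x)$, and a Jordan derivation if $\delta(x\circ y)=\delta(x)\circ y+x\circ\delta(y)$, for all $x,y$. A Jordan derivation $\delta$ is singular (with respect to $e$) if $\delta(e\mathcal{A}e)=\{0\}$, $\delta(f\mathcal{A}f)=\{0\}$, $\delta(e\mathcal{A}f)\subseteq f\mathcal{A}e$ and $\delta(f\mathcal{A}e)\subseteq e\mathcal{A}f$. A central ideal of an algebra is an ideal contained in its centre; $e\mathcal{A}e$ and $f\mathcal{A}f$ are unital algebras with units $e$ and $f$. *)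

theory Defs
  imports Complex_Main
begin

(* Associativity and the unit come from the sort ring_1 of the carrier, the scalars
   from comm_ring_1.  Both sorts include 0 \<noteq> 1, which is automatic as soon as the
   algebra contains an idempotent different from 0 and 1. *)
locale unital_algebra = module scale
  for scale :: "'r::comm_ring_1 \<Rightarrow> 'a::ring_1 \<Rightarrow> 'a" (infixr \<open>*s\<close> 75) +
  assumes scale_mult_left: "(r *s x) * y = r *s (x * y)"
    and scale_mult_right: "x * (r *s y) = r *s (x * y)"

abbreviation linear_map :: "('r::comm_ring_1 \<Rightarrow> 'a::ring_1 \<Rightarrow> 'a) \<Rightarrow> ('a \<Rightarrow> 'a) \<Rightarrow> bool" where
  "linear_map scale \<equiv> module_hom scale scale"

definition torsion_free :: "nat \<Rightarrow> 'a::ring_1 itself \<Rightarrow> bool" where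
  "torsion_free k _ \<longleftrightarrow> (\<forall>x::'a. of_nat k * x = 0 \<longrightarrow> x = 0)"

definition nontrivial_idempotent :: "'a::ring_1 \<Rightarrow> bool" where
  "nontrivial_idempotent e \<longleftrightarrow> e * e = e \<and> e \<noteq> 0 \<and> e \<noteq> 1"

definition corner :: "'a::ring_1 \<Rightarrow> 'a \<Rightarrow> 'a set" where
  "corner g h = {g * x * h |x. True}"

definition centre_of :: "'a::ring_1 set \<Rightarrow> 'a set" where
  "centre_of S = {z \<in> S. \<forall>x\<in>S. z * x = x * z}"

(* Two-sided algebra ideals, of a subset S that is meant to be a subalgebra. *)
definition ideal_of :: "('r::comm_ring_1 \<Rightarrow> 'a::ring_1 \<Rightarrow> 'a) \<Rightarrow> 'a set \<Rightarrow> 'a set \<Rightarrow> bool" where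
  "ideal_of scale S I \<longleftrightarrow>
     I \<subseteq> S \<and> module.subspace scale I \<and> (\<forall>s\<in>S. \<forall>a\<in>I. s * a \<in> I \<and> a * s \<in> I)"

definition central_ideal_of :: "('r::comm_ring_1 \<Rightarrow> 'a::ring_1 \<Rightarrow> 'a) \<Rightarrow> 'a set \<Rightarrow> 'a set \<Rightarrow> bool" where
  "central_ideal_of scale S I \<longleftrightarrow> ideal_of scale S I \<and> I \<subseteq> centre_of S"

definition commutator :: "'a::ring_1 \<Rightarrow> 'a \<Rightarrow> 'a" where
  "commutator x y = x * y - y * x"

definition jordan_product :: "'a::ring_1 \<Rightarrow> 'a \<Rightarrow> 'a" where
  "jordan_product x y = x * y + y * x"

(* The polynomial p_n evaluated at (x 1, ..., x n); the value at n = 0 is a dummy. *)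
fun p_comm :: "nat \<Rightarrow> (nat \<Rightarrow> 'a::ring_1) \<Rightarrow> 'a" where
  "p_comm 0 x = 0"
| "p_comm (Suc 0) x = x 1"
| "p_comm (Suc (Suc n)) x = commutator (p_comm (Suc n) x) (x (Suc (Suc n)))"

definition lie_n_derivation ::
    "('r::comm_ring_1 \<Rightarrow> 'a::ring_1 \<Rightarrow> 'a) \<Rightarrow> nat \<Rightarrow> ('a \<Rightarrow> 'a) \<Rightarrow> bool" where
  "lie_n_derivation scale n \<phi> \<longleftrightarrow> linear_map scale \<phi> \<and>
     (\<forall>x. \<phi> (p_comm n x) = (\<Sum>i = 1..n. p_comm n (x(i := \<phi> (x i)))))"

definition derivation :: "('r::comm_ring_1 \<Rightarrow> 'a::ring_1 \<Rightarrow> 'a) \<Rightarrow> ('a \<Rightarrow> 'a) \<Rightarrow> bool" where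
  "derivation scale d \<longleftrightarrow> linear_map scale d \<and>
     (\<forall>x y. d (x * y) = d x * y + x * d y)"

definition antiderivation :: "('r::comm_ring_1 \<Rightarrow> 'a::ring_1 \<Rightarrow> 'a) \<Rightarrow> ('a \<Rightarrow> 'a) \<Rightarrow> bool" where
  "antiderivation scale d \<longleftrightarrow> linear_map scale d \<and>
     (\<forall>x y. d (x * y) = d y * x + y * d x)"

definition jordan_derivation :: "('r::comm_ring_1 \<Rightarrow> 'a::ring_1 \<Rightarrow> 'a) \<Rightarrow> ('a \<Rightarrow> 'a) \<Rightarrow> bool" where
  "jordan_derivation scale d \<longleftrightarrow> linear_map scale d \<and>
     (\<forall>x y. d (jordan_product x y) = jordan_product (d x) y + jordan_product x (d y))"

definition singular_jordan_derivation ::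
    "('r::comm_ring_1 \<Rightarrow> 'a::ring_1 \<Rightarrow> 'a) \<Rightarrow> 'a \<Rightarrow> ('a \<Rightarrow> 'a) \<Rightarrow> bool" where
  "singular_jordan_derivation scale e d \<longleftrightarrow> jordan_derivation scale d \<and>
     (let f = 1 - e in
       d ` corner e e = {0} \<and> d ` corner f f = {0} \<and>
       d ` corner e f \<subseteq> corner f e \<and> d ` corner f e \<subseteq> corner e f)"

end

theory Submission
  imports Defs
begin

text \<open>Write \<open>M = eAf\<close> and \<open>N = fAe\<close> for the off-diagonal corners, so that the algebra is
\<open>eAe + M + N + fAf\<close>. The operator \<open>E = [_, e]\<close> kills the diagonal corners, is \<open>-1\<close> on \<open>M\<close>
and \<open>1\<close> on \<open>N\<close>. Once \<open>\<phi> e\<close> is central, every summand of the Leibniz sum in which \<open>\<phi>\<close> hits an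
entry \<open>e\<close> vanishes, so inserting tuples such as \<open>(x, y, e, \<dots>, e)\<close> turns the identity of order \<open>n\<close>
into short ones in one, two or three variables, dressed with powers of \<open>E\<close>
(\<open>lie_laws_if_central_image\<close>). Subtracting an inner derivation makes \<open>\<phi> e\<close> diagonal; then
\<open>(m, e, \<dots>, e)\<close> yields \<open>(n - 1) [m, \<phi> e] = 0\<close> for off-diagonal \<open>m\<close>, and torsion freeness together
with faithfulness makes \<open>\<phi> e\<close> central (\<open>image_of_idempotent_central\<close>).

The identity in one variable shows that \<open>\<phi>\<close> preserves both the diagonal and the off-diagonal part.
By hypothesis, the part of \<open>\<phi>\<close> that moves \<open>eAe\<close> into \<open>fAf\<close>, or conversely, extends to a central
element, which is the value of \<open>\<gamma>\<close>. The part exchanging \<open>M\<close> and \<open>N\<close> is \<open>\<delta>\<close>, and what remains is \<open>d\<close>,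
which preserves each of the four corners (\<open>splitting_exists\<close>). The identity in two variables makes
\<open>d\<close> a derivation, and \<open>\<delta>\<close> an antiderivation, for products of a diagonal and an off-diagonal element;
by faithfulness \<open>d\<close> is then a derivation on the diagonal corners.

Two obstructions remain: the elements \<open>\<gamma> [m, u]\<close> with \<open>m \<in> M\<close>, \<open>u \<in> N\<close>, which measure the failure
of \<open>d\<close> to be a derivation on \<open>M N\<close> and \<open>N M\<close>, and the commutators \<open>[\<delta> m, m']\<close> with \<open>m, m' \<in> M\<close>, which
collect the products \<open>\<delta> m m'\<close> and \<open>m' \<delta> m\<close> that must vanish for an antiderivation. Both families
consist of central elements, and their components in \<open>eAe\<close> and in \<open>fAf\<close> span central ideals. So in
one of these two corners all components vanish, and a central element with a vanishing diagonal
component is zero (\<open>\<gamma>_bracket_zero\<close>, \<open>\<delta>_kills_corner\<close>). Finally, by the vanishing products the values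
of \<open>\<delta>\<close> lie in an ideal without diagonal part; this ideal contains the whole \<open>\<delta>\<close>-part of the Leibniz
sum, so the central element \<open>\<gamma> (p_n(x_1, \<dots>, x_n))\<close> has no diagonal part either and is zero
(\<open>\<gamma>_p_comm\<close>).

All hypotheses are invariant under exchanging \<open>e\<close> and \<open>f\<close>: each locale below has a lemma to that
effect, by which a statement about one corner is transferred to the opposite one.\<close>

section \<open>Iterated commutators and Leibniz sums\<close>

lemma commutator_add_left: "commutator (x + y) z = commutator x z + commutator y z"
  and commutator_add_right: "commutator x (y + z) = commutator x y + commutator x z"
  and commutator_diff_left: "commutator (x - y) z = commutator x z - commutator y z"
  and commutator_diff_right: "commutator x (y - z) = commutator x y - commutator x z"
  and commutator_minus_left: "commutator (- x) z = - commutator x z"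
  and commutator_minus_right: "commutator x (- z) = - commutator x z"
  and commutator_zero_left [simp]: "commutator 0 z = 0"
  and commutator_zero_right [simp]: "commutator x 0 = 0"
  by (simp_all add: commutator_def algebra_simps)

lemmas commutator_linear =
  commutator_add_left commutator_add_right commutator_diff_left commutator_diff_right
  commutator_minus_left commutator_minus_right

lemma commutator_central [simp]:
  assumes "z \<in> centre_of UNIV"
  shows "commutator z x = 0" "commutator x z = 0"
  using assms by (simp_all add: centre_of_def commutator_def)

lemma central_zero: "0 \<in> centre_of UNIV"
  and central_add: "z \<in> centre_of UNIV \<Longrightarrow> w \<in> centre_of UNIV \<Longrightarrow> z + w \<in> centre_of UNIV"
  and central_diff: "z \<in> centre_of UNIV \<Longrightarrow> w \<in> centre_of UNIV \<Longrightarrow> z - w \<in> centre_of UNIV"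
  by (simp_all add: centre_of_def algebra_simps)

text \<open>The sum over all positions at which \<open>\<phi>\<close> is applied to one entry of \<open>p_comm n x\<close>, in recursive form:
peeling off the last entry makes it accessible to induction (see \<open>leibniz_eq_sum\<close>).\<close>

fun leibniz :: "('a::ring_1 \<Rightarrow> 'a) \<Rightarrow> nat \<Rightarrow> (nat \<Rightarrow> 'a) \<Rightarrow> 'a" where
  "leibniz \<phi> 0 x = 0"
| "leibniz \<phi> (Suc 0) x = \<phi> (x 1)"
| "leibniz \<phi> (Suc (Suc n)) x =
     commutator (leibniz \<phi> (Suc n) x) (x (Suc (Suc n))) +
     commutator (p_comm (Suc n) x) (\<phi> (x (Suc (Suc n))))"

lemma p_comm_upd_beyond: "n < i \<Longrightarrow> p_comm n (x(i := y)) = p_comm n x"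
  by (induction n x rule: p_comm.induct) auto

lemma commutator_sum_left: "commutator (\<Sum>i\<in>I. g i) y = (\<Sum>i\<in>I. commutator (g i) y)"
  by (simp add: commutator_def sum_distrib_left sum_distrib_right sum_subtractf)

lemma leibniz_eq_sum: "leibniz \<phi> n x = (\<Sum>i = 1..n. p_comm n (x(i := \<phi> (x i))))"
proof (induction \<phi> n x rule: leibniz.induct)
  case (3 \<phi> n x)
  have "(\<Sum>i = 1..Suc n. p_comm (Suc (Suc n)) (x(i := \<phi> (x i)))) =
      (\<Sum>i = 1..Suc n. commutator (p_comm (Suc n) (x(i := \<phi> (x i)))) (x (Suc (Suc n))))"
    by (intro sum.cong) auto
  moreover have "p_comm (Suc (Suc n)) (x(Suc (Suc n) := y)) = commutator (p_comm (Suc n) x) y" for y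
    by (simp add: p_comm_upd_beyond del: fun_upd_apply) simp
  ultimately have "(\<Sum>i = 1..Suc (Suc n). p_comm (Suc (Suc n)) (x(i := \<phi> (x i)))) =
      commutator (\<Sum>i = 1..Suc n. p_comm (Suc n) (x(i := \<phi> (x i)))) (x (Suc (Suc n))) +
      commutator (p_comm (Suc n) x) (\<phi> (x (Suc (Suc n))))"
    by (subst sum.nat_ivl_Suc')
      (simp_all only: commutator_sum_left add.commute[of "commutator (p_comm (Suc n) x) _"])
  then show ?case using 3 by (simp only: leibniz.simps)
qed auto

lemma leibniz_add: "leibniz (\<lambda>x. g x + h x) n x = leibniz g n x + leibniz h n x"
  by (induction g n x rule: leibniz.induct) (auto simp: commutator_linear)

lemma leibniz_diff: "leibniz (\<lambda>x. g x - h x) n x = leibniz g n x - leibniz h n x"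
  by (induction g n x rule: leibniz.induct) (auto simp: commutator_linear)

lemma leibniz_derivation:
  assumes "\<And>x y. d (x - y) = d x - d y" and "\<And>x y. d (x * y) = d x * y + x * d y"
  shows "leibniz d n x = d (p_comm n x)"
proof (induction n x rule: p_comm.induct)
  case (1 x)
  show ?case using assms(1)[of 0 0] by simp
qed (simp_all add: commutator_def assms algebra_simps)

lemma leibniz_central:
  assumes "\<And>x. g x \<in> centre_of UNIV" and "2 \<le> n"
  shows "leibniz g n x = 0"
  using assms(2)
proof (induction n x rule: p_comm.induct)
  case (3 n x)
  then show ?case by (cases n) (simp_all add: assms(1))
qed auto

text \<open>The sign convention is that of \<open>p_comm\<close>, where \<open>e\<close> is bracketed from the right:
\<open>p_comm\<close> of \<open>(w, e, \<dots>, e)\<close> with \<open>k\<close> entries \<open>e\<close> is \<open>ad_pow e k w\<close>.\<close>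

definition ad_pow :: "'a::ring_1 \<Rightarrow> nat \<Rightarrow> 'a \<Rightarrow> 'a" where
  "ad_pow e k = (\<lambda>w. commutator w e) ^^ k"

lemma ad_pow_0 [simp]: "ad_pow e 0 w = w"
  and ad_pow_Suc: "ad_pow e (Suc k) w = commutator (ad_pow e k w) e"
  by (simp_all add: ad_pow_def)

lemma ad_pow_add: "ad_pow e k (v + w) = ad_pow e k v + ad_pow e k w"
  and ad_pow_zero [simp]: "ad_pow e k 0 = 0"
  by (induction k) (simp_all add: ad_pow_Suc commutator_linear)

lemma sign_commute:
  "(x :: 'a::ring_1) * (- 1) ^ k = (- 1) ^ k * x" "x * ((- 1) ^ k * y) = (- 1) ^ k * (x * y)"
  by (cases "even k"; simp)+

lemma of_nat_commute: "(x :: 'a::ring_1) * (of_nat j * y) = of_nat j * (x * y)"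
  by (metis mult.assoc mult_of_nat_commute)

lemma sign_sign [simp]: "(- 1) ^ k * ((- 1) ^ k * x) = (x :: 'a::ring_1)"
  by (cases "even k"; simp)

lemma sign_cancel [simp]: "(- 1) ^ k * x = (- 1) ^ k * y \<longleftrightarrow> x = (y :: 'a::ring_1)"
  by (cases "even k"; simp)

text \<open>Passing from \<open>e\<close> to \<open>1 - e\<close> changes \<open>[_, e]\<close> only by a sign, so identities for additive maps in terms
of \<open>ad_pow\<close> are symmetric in the two idempotents.\<close>

lemma ad_pow_complement: "ad_pow (1 - e) k w = (- 1) ^ k * ad_pow e k w"
  by (induction k) (simp_all add: ad_pow_Suc commutator_def algebra_simps sign_commute)

lemma p_comm_tail:
  assumes "\<And>i. j < i \<Longrightarrow> x i = e" and "0 < j"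
  shows "p_comm (j + k) x = ad_pow e k (p_comm j x)"
proof (induction k)
  case (Suc k)
  obtain i where i: "j + k = Suc i" using assms(2) by (cases "j + k") auto
  show ?case using Suc i assms(1)[of "Suc (Suc i)"] by (simp add: ad_pow_Suc)
qed simp

text \<open>The terms in which \<open>\<phi>\<close> hits one of the trailing entries \<open>e\<close> are commutators with the central element
\<open>\<phi> e\<close>, hence zero.\<close>

lemma leibniz_tail:
  assumes "\<And>i. j < i \<Longrightarrow> x i = e" and "0 < j" and "\<phi> e \<in> centre_of UNIV"
  shows "leibniz \<phi> (j + k) x = ad_pow e k (leibniz \<phi> j x)"
proof (induction k)
  case (Suc k)
  obtain i where i: "j + k = Suc i" using assms(2) by (cases "j + k") auto
  show ?case using Suc i assms(1)[of "Suc (Suc i)"] assms(3) by (simp add: ad_pow_Suc)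
qed simp

lemma p_comm_cong: "(\<And>i. 0 < i \<Longrightarrow> i \<le> n \<Longrightarrow> x i = y i) \<Longrightarrow> p_comm n x = p_comm n y"
  by (induction n x rule: p_comm.induct) auto

lemma leibniz_cong: "(\<And>i. 0 < i \<Longrightarrow> i \<le> n \<Longrightarrow> x i = y i) \<Longrightarrow> leibniz \<phi> n x = leibniz \<phi> n y"
  by (induction \<phi> n x rule: leibniz.induct)
    (auto intro!: arg_cong2[where f = "(+)"] arg_cong2[where f = commutator] p_comm_cong)

text \<open>The four identities come from the tuples \<open>(y, e, \<dots>, e)\<close>, \<open>(y, z, e, \<dots>, e)\<close>, \<open>(y, e, \<dots>, e, z)\<close>
and \<open>(y, z, w, e, \<dots>, e)\<close> of length \<open>k + 2\<close>; the last one needs length at least three.\<close>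

lemma lie_laws_if_central_image:
  fixes e :: "'a::ring_1"
  assumes leib: "\<And>x. \<phi> (p_comm (Suc (Suc k)) x) = leibniz \<phi> (Suc (Suc k)) x"
    and central: "\<phi> e \<in> centre_of UNIV"
  shows "\<phi> (ad_pow e (Suc k) y) = ad_pow e (Suc k) (\<phi> y)"
    and "\<phi> (ad_pow e k (commutator y z)) = ad_pow e k (commutator (\<phi> y) z + commutator y (\<phi> z))"
    and "\<phi> (commutator (ad_pow e k y) z) =
      commutator (ad_pow e k (\<phi> y)) z + commutator (ad_pow e k y) (\<phi> z)"
    and "0 < k \<Longrightarrow> \<phi> (ad_pow e (k - 1) (commutator (commutator y z) w)) =
      ad_pow e (k - 1) (commutator (commutator (\<phi> y) z + commutator y (\<phi> z)) w +
        commutator (commutator y z) (\<phi> w))"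
proof -
  let ?x1 = "\<lambda>i :: nat. if i = 1 then y else e"
  note t1 = p_comm_tail[of 1 ?x1 e] leibniz_tail[of 1 ?x1 e \<phi>, OF _ _ central]
  show "\<phi> (ad_pow e (Suc k) y) = ad_pow e (Suc k) (\<phi> y)"
    using leib[of ?x1] t1[of "Suc k"] by simp
  let ?x2 = "\<lambda>i :: nat. if i = 1 then y else if i = 2 then z else e"
  show "\<phi> (ad_pow e k (commutator y z)) = ad_pow e k (commutator (\<phi> y) z + commutator y (\<phi> z))"
    using leib[of ?x2] p_comm_tail[of 2 ?x2 e k] leibniz_tail[of 2 ?x2 e \<phi> k, OF _ _ central]
    by (simp add: numeral_2_eq_2)
  let ?x3 = "\<lambda>i :: nat. if i = 1 then y else if i = Suc (Suc k) then z else e"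
  have "p_comm (Suc k) ?x3 = p_comm (Suc k) ?x1" by (rule p_comm_cong) simp
  moreover have "leibniz \<phi> (Suc k) ?x3 = leibniz \<phi> (Suc k) ?x1" by (rule leibniz_cong) simp
  ultimately show "\<phi> (commutator (ad_pow e k y) z) =
      commutator (ad_pow e k (\<phi> y)) z + commutator (ad_pow e k y) (\<phi> z)"
    using leib[of ?x3] t1[of k] by simp
  let ?x4 = "\<lambda>i :: nat. if i = 1 then y else if i = 2 then z else if i = 3 then w else e"
  assume "0 < k"
  then have "Suc (Suc k) = 3 + (k - 1)" by simp
  then show "\<phi> (ad_pow e (k - 1) (commutator (commutator y z) w)) =
      ad_pow e (k - 1) (commutator (commutator (\<phi> y) z + commutator y (\<phi> z)) w +
        commutator (commutator y z) (\<phi> w))"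
    using leib[of ?x4] p_comm_tail[of 3 ?x4 e "k - 1"]
      leibniz_tail[of 3 ?x4 e \<phi> "k - 1", OF _ _ central]
    by (simp add: numeral_2_eq_2 numeral_3_eq_3)
qed

section \<open>The Peirce decomposition\<close>

locale peirce =
  fixes e f :: "'a::ring_1"
  assumes idem: "e * e = e" and complement: "f = 1 - e"
begin

lemma swap: "peirce f e"
  by unfold_locales (simp_all add: complement algebra_simps idem)

lemma idem_f: "f * f = f" and ef: "e * f = 0" and fe: "f * e = 0" and sum_one: "e + f = 1"
  by (simp_all add: complement algebra_simps idem)

lemma corner_iff:
  "x \<in> corner e e \<longleftrightarrow> e * x = x \<and> x * e = x"
  "x \<in> corner e f \<longleftrightarrow> e * x = x \<and> x * f = x"
  "x \<in> corner f e \<longleftrightarrow> f * x = x \<and> x * e = x"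
  "x \<in> corner f f \<longleftrightarrow> f * x = x \<and> x * f = x"
  unfolding corner_def using idem idem_f by (auto; metis mult.assoc)+

lemma corner_kill:
  "x \<in> corner e e \<Longrightarrow> f * x = 0" "x \<in> corner e f \<Longrightarrow> f * x = 0"
  "x \<in> corner f e \<Longrightarrow> e * x = 0" "x \<in> corner f f \<Longrightarrow> e * x = 0"
  "x \<in> corner e e \<Longrightarrow> x * f = 0" "x \<in> corner f e \<Longrightarrow> x * f = 0"
  "x \<in> corner e f \<Longrightarrow> x * e = 0" "x \<in> corner f f \<Longrightarrow> x * e = 0"
  unfolding corner_iff using ef fe by (metis mult.assoc mult_zero_left mult_zero_right)+

lemma idem_simps:
  "e * e = e" "f * f = f" "e * f = 0" "f * e = 0"
  "e * (e * x) = e * x" "f * (f * x) = f * x" "e * (f * x) = 0" "f * (e * x) = 0"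
  by (simp_all add: idem idem_f ef fe mult.assoc[symmetric])

lemma corner_components [simp]:
  "e * x * e \<in> corner e e" "e * x * f \<in> corner e f"
  "f * x * e \<in> corner f e" "f * x * f \<in> corner f f"
  by (auto simp: corner_def)

lemma decomposition: "x = e * x * e + e * x * f + f * x * e + f * x * f"
proof -
  have "x = (e + f) * x * (e + f)" by (simp add: sum_one)
  then show ?thesis by (simp add: algebra_simps)
qed

lemma corner_project:
  "x \<in> corner e e \<Longrightarrow> e * x * e = x" "x \<in> corner e e \<Longrightarrow> e * x * f = 0"
  "x \<in> corner e e \<Longrightarrow> f * x * e = 0" "x \<in> corner e e \<Longrightarrow> f * x * f = 0"
  "x \<in> corner e f \<Longrightarrow> e * x * e = 0" "x \<in> corner e f \<Longrightarrow> e * x * f = x"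
  "x \<in> corner e f \<Longrightarrow> f * x * e = 0" "x \<in> corner e f \<Longrightarrow> f * x * f = 0"
  "x \<in> corner f e \<Longrightarrow> e * x * e = 0" "x \<in> corner f e \<Longrightarrow> e * x * f = 0"
  "x \<in> corner f e \<Longrightarrow> f * x * e = x" "x \<in> corner f e \<Longrightarrow> f * x * f = 0"
  "x \<in> corner f f \<Longrightarrow> e * x * e = 0" "x \<in> corner f f \<Longrightarrow> e * x * f = 0"
  "x \<in> corner f f \<Longrightarrow> f * x * e = 0" "x \<in> corner f f \<Longrightarrow> f * x * f = x"
  by (simp_all add: corner_kill mult.assoc) (simp_all add: corner_iff)

lemma corner_mult:
  "x \<in> corner e e \<Longrightarrow> y \<in> corner e e \<Longrightarrow> x * y \<in> corner e e"
  "x \<in> corner e e \<Longrightarrow> y \<in> corner e f \<Longrightarrow> x * y \<in> corner e f"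
  "x \<in> corner e f \<Longrightarrow> y \<in> corner f e \<Longrightarrow> x * y \<in> corner e e"
  "x \<in> corner e f \<Longrightarrow> y \<in> corner f f \<Longrightarrow> x * y \<in> corner e f"
  "x \<in> corner f e \<Longrightarrow> y \<in> corner e e \<Longrightarrow> x * y \<in> corner f e"
  "x \<in> corner f e \<Longrightarrow> y \<in> corner e f \<Longrightarrow> x * y \<in> corner f f"
  "x \<in> corner f f \<Longrightarrow> y \<in> corner f e \<Longrightarrow> x * y \<in> corner f e"
  "x \<in> corner f f \<Longrightarrow> y \<in> corner f f \<Longrightarrow> x * y \<in> corner f f"
  unfolding corner_iff by (metis mult.assoc)+

lemma corner_mult_zero:
  "x \<in> corner e e \<Longrightarrow> y \<in> corner f e \<Longrightarrow> x * y = 0"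
  "x \<in> corner e e \<Longrightarrow> y \<in> corner f f \<Longrightarrow> x * y = 0"
  "x \<in> corner e f \<Longrightarrow> y \<in> corner e e \<Longrightarrow> x * y = 0"
  "x \<in> corner e f \<Longrightarrow> y \<in> corner e f \<Longrightarrow> x * y = 0"
  "x \<in> corner f e \<Longrightarrow> y \<in> corner f e \<Longrightarrow> x * y = 0"
  "x \<in> corner f e \<Longrightarrow> y \<in> corner f f \<Longrightarrow> x * y = 0"
  "x \<in> corner f f \<Longrightarrow> y \<in> corner e e \<Longrightarrow> x * y = 0"
  "x \<in> corner f f \<Longrightarrow> y \<in> corner e f \<Longrightarrow> x * y = 0"
  unfolding corner_iff by (metis ef fe mult.assoc mult_zero_left mult_zero_right)+

lemma corner_linear:
  "0 \<in> corner g h"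
  "x \<in> corner g h \<Longrightarrow> y \<in> corner g h \<Longrightarrow> x + y \<in> corner g h"
  "x \<in> corner g h \<Longrightarrow> y \<in> corner g h \<Longrightarrow> x - y \<in> corner g h"
  "x \<in> corner g h \<Longrightarrow> - x \<in> corner g h"
proof -
  show "0 \<in> corner g h" unfolding corner_def by (auto intro!: exI[of _ 0])
  { fix x y assume "x \<in> corner g h" "y \<in> corner g h"
    then obtain u v where "x = g * u * h" "y = g * v * h" by (auto simp: corner_def)
    then have "x + y = g * (u + v) * h" "x - y = g * (u - v) * h" by (simp_all add: algebra_simps)
    then show "x + y \<in> corner g h" "x - y \<in> corner g h" by (auto simp: corner_def) }
  note this(2)[OF \<open>0 \<in> corner g h\<close>]
  then show "x \<in> corner g h \<Longrightarrow> - x \<in> corner g h" by simp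
qed

lemmas corner_rules = corner_mult corner_mult_zero corner_linear

lemma biadditive_eq:
  assumes "\<And>x y z. T (x + y) z = T x z + T y z" "\<And>x y z. T x (y + z) = T x y + T x z"
    and "\<And>x y z. S (x + y) z = S x z + S y z" "\<And>x y z. S x (y + z) = S x y + S x z"
    and "\<And>x y. x \<in> corner e e \<union> corner e f \<union> corner f e \<union> corner f f \<Longrightarrow>
      y \<in> corner e e \<union> corner e f \<union> corner f e \<union> corner f f \<Longrightarrow> T x y = S x y"
  shows "(T x y :: 'a) = S x y"
  by (subst (1 2) decomposition[of x], subst (1 2) decomposition[of y])
    (simp add: assms)

text \<open>On \<open>eAf\<close> the operator \<open>[_, e]\<close> is \<open>-1\<close>, on \<open>fAe\<close> it is the identity, and it kills both diagonal corners.\<close>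

lemma ad_pow_project:
  "e * ad_pow e k w * f = (- 1) ^ k * (e * w * f)" "f * ad_pow e k w * e = f * w * e"
  "0 < k \<Longrightarrow> e * ad_pow e k w * e = 0" "0 < k \<Longrightarrow> f * ad_pow e k w * f = 0"
proof -
  show "e * ad_pow e k w * f = (- 1) ^ k * (e * w * f)"
    by (induction k)
      (simp_all add: ad_pow_Suc commutator_def right_diff_distrib left_diff_distrib
        mult.assoc idem_simps sign_commute)
  show "f * ad_pow e k w * e = f * w * e"
    by (induction k)
      (simp_all add: ad_pow_Suc commutator_def right_diff_distrib left_diff_distrib
        mult.assoc idem_simps)
  assume "0 < k"
  then obtain j where "k = Suc j" by (cases k) auto
  then show "e * ad_pow e k w * e = 0" "f * ad_pow e k w * f = 0"
    by (simp_all add: ad_pow_Suc commutator_def right_diff_distrib left_diff_distrib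
        mult.assoc idem_simps)
qed

lemma ad_pow_corner:
  "m \<in> corner e f \<Longrightarrow> ad_pow e k m = (- 1) ^ k * m"
  "m \<in> corner f e \<Longrightarrow> ad_pow e k m = m"
proof -
  assume "m \<in> corner e f"
  then have "e * m = m" "m * e = 0" by (simp_all add: corner_kill, simp add: corner_iff)
  then show "ad_pow e k m = (- 1) ^ k * m"
    by (induction k) (simp_all add: ad_pow_Suc commutator_def sign_commute mult.assoc)
next
  assume "m \<in> corner f e"
  then have "m * e = m" "e * m = 0" by (simp_all add: corner_kill, simp add: corner_iff)
  then show "ad_pow e k m = m"
    by (induction k) (simp_all add: ad_pow_Suc commutator_def)
qed

lemma ad_pow_diagonal:
  assumes "a \<in> corner e e \<or> a \<in> corner f f" and "0 < k"
  shows "ad_pow e k a = 0"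
proof -
  have "commutator a e = 0"
    using assms(1)
  proof
    assume "a \<in> corner e e"
    then have "a * e = a" "e * a = a" by (simp_all only: corner_iff)
    then show ?thesis by (simp add: commutator_def)
  next
    assume "a \<in> corner f f"
    then show ?thesis by (simp add: commutator_def corner_kill)
  qed
  then have "ad_pow e (Suc j) a = 0" for j
    by (induction j) (simp_all add: ad_pow_Suc)
  then show ?thesis using assms(2) by (cases k) auto
qed

end

section \<open>Faithful off-diagonal corners and the centre\<close>

locale faithful_peirce = peirce +
  assumes faithful_e:
      "a \<in> corner e e \<Longrightarrow> \<forall>m\<in>corner e f. a * m = 0 \<Longrightarrow> \<forall>m\<in>corner f e. m * a = 0 \<Longrightarrow> a = 0"
    and faithful_f:
      "a \<in> corner f f \<Longrightarrow> \<forall>m\<in>corner f e. a * m = 0 \<Longrightarrow> \<forall>m\<in>corner e f. m * a = 0 \<Longrightarrow> a = 0"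
begin

lemma swap_faithful: "faithful_peirce f e"
  using swap faithful_e faithful_f by (simp add: faithful_peirce_def faithful_peirce_axioms_def)

text \<open>For \<open>x \<in> eAe\<close>, moving the diagonal components \<open>a\<close> and \<open>b\<close> of \<open>c\<close> across \<open>m \<in> eAf\<close> gives
\<open>a x m = x m b = x a m\<close>, and similarly on the other side, so \<open>[a, x]\<close> annihilates the off-diagonal
corners and vanishes by faithfulness.\<close>

lemma central_if_commutes:
  assumes "e * c * f = 0" "f * c * e = 0"
    and "\<And>m. m \<in> corner e f \<Longrightarrow> commutator c m = 0"
    and "\<And>m. m \<in> corner f e \<Longrightarrow> commutator c m = 0"
  shows "c \<in> centre_of UNIV"
proof -
  have cm: "c * m = m * c" if "m \<in> corner e f \<or> m \<in> corner f e" for m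
    using assms(3,4) that by (auto simp: commutator_def)
  define a b where "a = e * c * e" and "b = f * c * f"
  have ab: "a \<in> corner e e" "b \<in> corner f f" by (simp_all add: a_def b_def)
  have c: "c = a + b" using decomposition[of c] assms(1,2) by (simp add: a_def b_def)
  have am: "a * m = m * b" if "m \<in> corner e f" for m
    using cm[of m] that ab by (simp add: c algebra_simps corner_mult_zero)
  have bm: "b * m = m * a" if "m \<in> corner f e" for m
    using cm[of m] that ab by (simp add: c algebra_simps corner_mult_zero)
  have "a * x - x * a = 0" if x: "x \<in> corner e e" for x
  proof (rule faithful_e)
    show "a * x - x * a \<in> corner e e" using x ab by (simp add: corner_rules)
    show "\<forall>m\<in>corner e f. (a * x - x * a) * m = 0"
      using am corner_mult(2)[OF x] by (simp add: left_diff_distrib mult.assoc)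
    show "\<forall>m\<in>corner f e. m * (a * x - x * a) = 0"
      using bm[symmetric] corner_mult(5)[OF _ x] by (simp add: right_diff_distrib mult.assoc[symmetric])
  qed
  moreover have "b * x - x * b = 0" if x: "x \<in> corner f f" for x
  proof (rule faithful_f)
    show "b * x - x * b \<in> corner f f" using x ab by (simp add: corner_rules)
    show "\<forall>m\<in>corner f e. (b * x - x * b) * m = 0"
      using bm corner_mult(7)[OF x] by (simp add: left_diff_distrib mult.assoc)
    show "\<forall>m\<in>corner e f. m * (b * x - x * b) = 0"
      using am[symmetric] corner_mult(4)[OF _ x] by (simp add: right_diff_distrib mult.assoc[symmetric])
  qed
  ultimately have diag: "c * x = x * c" if "x \<in> corner e e \<or> x \<in> corner f f" for x
    using that ab by (auto simp: c algebra_simps corner_mult_zero)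
  have "c * x = x * c" for x
  proof -
    have "c * (e * x * e + e * x * f + f * x * e + f * x * f) =
        (e * x * e + e * x * f + f * x * e + f * x * f) * c"
      unfolding distrib_left distrib_right by (simp add: cm diag del: mult.assoc)
    then show ?thesis by (simp add: decomposition[symmetric])
  qed
  then show ?thesis by (simp add: centre_of_def)
qed

lemma central_diagonal:
  assumes "z \<in> centre_of UNIV"
  shows "e * z * f = 0" "f * z * e = 0"
proof -
  have "e * z = z * e" "f * z = z * f" using assms by (simp_all add: centre_of_def)
  then show "e * z * f = 0" "f * z * e = 0" by (simp_all add: mult.assoc ef fe)
qed

text \<open>Such a \<open>z\<close> lies in \<open>eAe\<close>, so for \<open>m \<in> eAf\<close> it satisfies \<open>z m = m z = 0\<close>, and likewise for \<open>fAe\<close>.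
In particular a central element is determined by either of its diagonal components.\<close>

lemma central_zero_if_f_zero:
  assumes "z \<in> centre_of UNIV" and "f * z * f = 0"
  shows "z = 0"
proof -
  have z: "z * x = x * z" for x using assms by (simp add: centre_of_def)
  have "z = e * z * e"
    using decomposition[of z] assms(2) central_diagonal[OF assms(1)] by simp
  then have ze: "z \<in> corner e e" by (metis corner_components(1))
  show ?thesis
  proof (rule faithful_e[OF ze])
    show "\<forall>m\<in>corner e f. z * m = 0" using z ze corner_mult_zero(3) by metis
    show "\<forall>m\<in>corner f e. m * z = 0" using z ze corner_mult_zero(1) by metis
  qed
qed

end

text \<open>The form in which the absence of central ideals is used. The components \<open>e z\<close> are central in \<open>eAe\<close>
and the closure condition makes their span an ideal of \<open>eAe\<close>; once these components vanish, so do
the elements \<open>z\<close> themselves.\<close>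

lemma (in faithful_peirce) no_central_family:
  assumes algebra: "unital_algebra scale"
    and no_ideal: "\<nexists>I. central_ideal_of scale (corner e e) I \<and> I \<noteq> {0}"
    and Z: "Z \<subseteq> centre_of UNIV" and closed: "\<forall>z\<in>Z. \<forall>a\<in>corner e e. \<exists>w\<in>Z. a * z = e * w"
  shows "Z \<subseteq> {0}"
proof
  fix z assume "z \<in> Z"
  interpret unital_algebra scale by (rule algebra)
  interpret sw: faithful_peirce f e by (rule swap_faithful)
  let ?I = "span ((*) e ` Z)"
  have scale_corner: "scale r x \<in> corner e e" if "x \<in> corner e e" for r x
    using that by (simp add: corner_iff scale_mult_left scale_mult_right)
  have commutes: "w * x = x * w" if "w \<in> Z" for w x
    using Z that by (auto simp: centre_of_def)
  have gen: "(*) e ` Z \<subseteq> centre_of (corner e e)"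
  proof
    fix x assume "x \<in> (*) e ` Z"
    then obtain w where w: "w \<in> Z" "x = e * w" by blast
    have "x = e * w * e" using w commutes[OF w(1), of e] by (simp add: mult.assoc idem_simps)
    then have x: "x \<in> corner e e" by (metis corner_components(1))
    have "x * a = a * x" if "a \<in> corner e e" for a
    proof -
      have "e * (w * a) = e * a * w" by (simp add: commutes[OF w(1)] mult.assoc)
      also have "\<dots> = a * e * w" using that by (simp add: corner_iff)
      finally show ?thesis by (simp add: w(2) mult.assoc)
    qed
    with x show "x \<in> centre_of (corner e e)" by (simp add: centre_of_def)
  qed
  have "subspace (centre_of (corner e e))"
    by (rule subspaceI)
      (auto simp: centre_of_def corner_linear scale_corner distrib_left distrib_right
        scale_mult_left scale_mult_right)
  then have central: "?I \<subseteq> centre_of (corner e e)" using gen by (simp add: span_minimal)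
  have left: "s * x \<in> ?I" if s: "s \<in> corner e e" and "x \<in> ?I" for s x
  proof -
    have "subspace {x. s * x \<in> ?I}"
      by (rule subspaceI)
        (auto simp: distrib_left scale_mult_right span_zero span_add span_scale)
    moreover have "(*) e ` Z \<subseteq> {x. s * x \<in> ?I}"
    proof
      fix x assume "x \<in> (*) e ` Z"
      then obtain w where w: "w \<in> Z" "x = e * w" by blast
      then obtain w' where "w' \<in> Z" "s * w = e * w'" using closed s by blast
      moreover have "s * x = s * w" using s w by (simp add: corner_iff mult.assoc[symmetric])
      ultimately show "x \<in> {x. s * x \<in> ?I}" by (simp add: span_base)
    qed
    ultimately show ?thesis using that(2) span_minimal by blast
  qed
  have "x * s \<in> ?I" if "s \<in> corner e e" "x \<in> ?I" for s x
    using left[OF that] central that by (auto simp: centre_of_def)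
  then have "central_ideal_of scale (corner e e) ?I"
    using left central by (auto simp: central_ideal_of_def ideal_of_def centre_of_def subspace_span)
  then have "?I = {0}" using no_ideal by blast
  moreover have "e * z \<in> ?I" using \<open>z \<in> Z\<close> by (simp add: span_base)
  ultimately have "e * z * e = 0" by simp
  then have "z = 0" using \<open>z \<in> Z\<close> Z by (blast intro: sw.central_zero_if_f_zero)
  then show "z \<in> {0}" by simp
qed

text \<open>Evaluate the identity on \<open>(m, e, \<dots>, e)\<close> with off-diagonal \<open>m\<close>. The bracket \<open>[m, \<phi> e]\<close> lies in the same
corner as \<open>m\<close>, so each of the \<open>k + 1\<close> positions of \<open>\<phi> e\<close> contributes the same multiple \<open>\<plusminus>1\<close> of it,
while the remaining terms cancel in that corner.\<close>

lemma (in faithful_peirce) image_of_idempotent_central: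
  assumes leib: "\<And>x. \<phi> (p_comm (Suc (Suc k)) x) = leibniz \<phi> (Suc (Suc k)) x"
    and add: "\<And>x y. \<phi> (x + y) = \<phi> x + \<phi> y"
    and diagonal: "e * \<phi> e * f = 0" "f * \<phi> e * e = 0"
    and torsion: "\<And>w :: 'a. of_nat (Suc k) * w = 0 \<Longrightarrow> w = 0"
  shows "\<phi> e \<in> centre_of UNIV"
proof (rule central_if_commutes[OF diagonal])
  define c where "c = \<phi> e"
  define a b where "a = e * c * e" and "b = f * c * f"
  have ab: "a \<in> corner e e" "b \<in> corner f f" by (simp_all add: a_def b_def)
  have c: "c = a + b" using decomposition[of c] diagonal by (simp add: a_def b_def c_def)
  have zero: "\<phi> 0 = 0" using add[of 0 0] by simp
  have minus: "\<phi> (- x) = - \<phi> x" for x using add[of x "- x"] zero by (simp add: minus_unique)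
  have sign: "\<phi> ((- 1) ^ j * x) = (- 1) ^ j * \<phi> x" for j x
    by (cases "even j") (simp_all add: minus)
  have scaled: "commutator (of_nat j * v) w = of_nat j * commutator v w"
    "commutator ((- 1) ^ j * v) w = (- 1) ^ j * commutator v w" for j and v w :: 'a
  proof -
    show "commutator (of_nat j * v) w = of_nat j * commutator v w"
      by (simp add: commutator_def right_diff_distrib of_nat_commute mult.assoc)
    show "commutator ((- 1) ^ j * v) w = (- 1) ^ j * commutator v w"
      by (simp add: commutator_def right_diff_distrib sign_commute mult.assoc)
  qed
  have pull: "e * (of_nat j * v) * f = of_nat j * (e * v * f)"
    "e * ((- 1) ^ j * v) * f = (- 1) ^ j * (e * v * f)" for j v
    by (simp only: of_nat_commute mult.assoc, simp only: sign_commute mult.assoc)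
  let ?x = "\<lambda>m i. if i = Suc 0 then m else e"
  have p: "p_comm (Suc j) (?x m) = ad_pow e j m" for j m
    using p_comm_tail[of 1 "?x m" e j] by simp
  {
    fix m assume m: "m \<in> corner e f"
    let ?b = "commutator m c"
    have b: "?b \<in> corner e f"
      using m ab by (simp add: c commutator_def distrib_left distrib_right corner_rules)
    have be: "commutator ?b e = - ?b"
      using ad_pow_corner(1)[OF b, of 1] by (simp add: ad_pow_Suc)
    \<comment> \<open>The \<open>j\<close> positions of \<open>\<phi> e\<close> all contribute the same element.\<close>
    have L: "leibniz \<phi> (Suc j) (?x m) = ad_pow e j (\<phi> m) - of_nat j * ((- 1) ^ j * ?b)" for j
    proof (induction j)
      case (Suc j)
      then show ?case
        by (simp add: p ad_pow_Suc commutator_linear scaled be ad_pow_corner(1)[OF m]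
            flip: c_def) (simp add: algebra_simps)
    qed simp
    have "(- 1) ^ Suc k * \<phi> m = ad_pow e (Suc k) (\<phi> m) - of_nat (Suc k) * ((- 1) ^ Suc k * ?b)"
      using leib[of "?x m"] unfolding L p ad_pow_corner(1)[OF m] sign .
    then have "e * ((- 1) ^ Suc k * \<phi> m) * f =
        e * ad_pow e (Suc k) (\<phi> m) * f - e * (of_nat (Suc k) * ((- 1) ^ Suc k * ?b)) * f"
      by (simp only: right_diff_distrib left_diff_distrib)
    moreover have "e * ((- 1) ^ Suc k * \<phi> m) * f = (- 1) ^ Suc k * (e * \<phi> m * f)"
      by (rule pull)
    moreover have "e * (of_nat (Suc k) * ((- 1) ^ Suc k * ?b)) * f =
        of_nat (Suc k) * ((- 1) ^ Suc k * (e * ?b * f))"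
      by (simp only: pull)
    ultimately have "of_nat (Suc k) * ((- 1) ^ Suc k * ?b) = 0"
      unfolding ad_pow_project(1) corner_project(6)[OF b] by simp
    then have "(- 1) ^ Suc k * ?b = 0" by (rule torsion)
    then have "?b = 0" using sign_cancel[of "Suc k" ?b 0] by simp
    then show "commutator (\<phi> e) m = 0" by (simp add: c_def commutator_def)
  }
  {
    fix m assume m: "m \<in> corner f e"
    let ?b = "commutator m c"
    have b: "?b \<in> corner f e"
      using m ab by (simp add: c commutator_def distrib_left distrib_right corner_rules)
    have be: "commutator ?b e = ?b"
      using ad_pow_corner(2)[OF b, of 1] by (simp add: ad_pow_Suc)
    have L: "leibniz \<phi> (Suc j) (?x m) = ad_pow e j (\<phi> m) + of_nat j * ?b" for j
    proof (induction j)
      case (Suc j)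
      then show ?case
        by (simp add: p ad_pow_Suc commutator_linear scaled be ad_pow_corner(2)[OF m]
            flip: c_def) (simp add: algebra_simps)
    qed simp
    have "\<phi> m = ad_pow e (Suc k) (\<phi> m) + of_nat (Suc k) * ?b"
      using leib[of "?x m"] unfolding L p ad_pow_corner(2)[OF m] .
    then have "f * \<phi> m * e = f * ad_pow e (Suc k) (\<phi> m) * e + f * (of_nat (Suc k) * ?b) * e"
      by (metis distrib_left distrib_right)
    moreover have "f * (of_nat (Suc k) * ?b) * e = of_nat (Suc k) * (f * ?b * e)"
      by (simp only: of_nat_commute mult.assoc)
    ultimately have "of_nat (Suc k) * ?b = 0"
      unfolding ad_pow_project(2) corner_project(11)[OF b] by simp
    then have "?b = 0" by (rule torsion)
    then show "commutator (\<phi> e) m = 0" by (simp add: c_def commutator_def)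
  }
qed

section \<open>Consequences of the Lie identities\<close>

text \<open>The tuple identities are assumed here only in terms of powers of \<open>[_, e]\<close>, so that exchanging \<open>e\<close> and
\<open>f\<close> preserves the assumptions; the number \<open>k\<close> stands for \<open>n - 2\<close>.\<close>

locale lie_laws = faithful_peirce e f for e f :: "'a::ring_1" +
  fixes k :: nat and \<phi> :: "'a \<Rightarrow> 'a"
  assumes phi_add: "\<phi> (x + y) = \<phi> x + \<phi> y"
    and phi_ad_pow: "\<phi> (ad_pow e (Suc k) x) = ad_pow e (Suc k) (\<phi> x)"
    and phi_ad_pow_commutator: "\<phi> (ad_pow e k (commutator x y)) =
      ad_pow e k (commutator (\<phi> x) y + commutator x (\<phi> y))"
    and phi_commutator_ad_pow: "\<phi> (commutator (ad_pow e k x) y) =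
      commutator (ad_pow e k (\<phi> x)) y + commutator (ad_pow e k x) (\<phi> y)"
    and phi_ad_pow_double_commutator: "0 < k \<Longrightarrow> \<phi> (ad_pow e (k - 1) (commutator (commutator x y) z)) =
      ad_pow e (k - 1) (commutator (commutator (\<phi> x) y + commutator x (\<phi> y)) z +
        commutator (commutator x y) (\<phi> z))"
    and two_torsion_free: "x + x = 0 \<Longrightarrow> x = 0"
begin

lemma phi_zero [simp]: "\<phi> 0 = 0"
  using phi_add[of 0 0] by simp

lemma phi_minus: "\<phi> (- x) = - \<phi> x"
  using phi_add[of x "- x"] by (simp add: minus_unique)

lemma phi_sign: "\<phi> ((- 1) ^ j * x) = (- 1) ^ j * \<phi> x"
  by (cases "even j") (simp_all add: phi_minus)

lemma swap_lie_laws: "lie_laws f e k \<phi>"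
proof -
  interpret sw: faithful_peirce f e by (rule swap_faithful)
  have ad: "ad_pow f j w = (- 1) ^ j * ad_pow e j w" for j w
    using ad_pow_complement[of e] by (simp add: complement)
  have cs: "commutator ((- 1) ^ j * v) w = (- 1) ^ j * commutator v w" for j and v w :: 'a
    by (cases "even j") (simp_all add: commutator_linear)
  show ?thesis
  proof
    fix x y z :: 'a
    show "\<phi> (x + y) = \<phi> x + \<phi> y" by (rule phi_add)
    show "\<phi> (ad_pow f (Suc k) x) = ad_pow f (Suc k) (\<phi> x)"
      unfolding ad phi_sign phi_ad_pow ..
    show "\<phi> (ad_pow f k (commutator x y)) =
        ad_pow f k (commutator (\<phi> x) y + commutator x (\<phi> y))"
      unfolding ad phi_sign phi_ad_pow_commutator ..
    show "\<phi> (commutator (ad_pow f k x) y) =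
        commutator (ad_pow f k (\<phi> x)) y + commutator (ad_pow f k x) (\<phi> y)"
      unfolding ad cs phi_sign phi_commutator_ad_pow distrib_left ..
    show "\<phi> (ad_pow f (k - 1) (commutator (commutator x y) z)) =
        ad_pow f (k - 1) (commutator (commutator (\<phi> x) y + commutator x (\<phi> y)) z +
          commutator (commutator x y) (\<phi> z))" if "0 < k"
      unfolding ad phi_sign phi_ad_pow_double_commutator[OF that] ..
    show "x = 0" if "x + x = 0" using that by (rule two_torsion_free)
  qed
qed

text \<open>For even \<open>k\<close> this forces twice the component to vanish, for odd \<open>k\<close> it is vacuous. Keeping the sign
symbolic treats both parities at once.\<close>

lemma sign_f_component:
  assumes "m \<in> corner e f"
  shows "f * \<phi> m * e = - ((- 1) ^ k * (f * \<phi> m * e))"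
proof -
  have "f * \<phi> ((- 1) ^ Suc k * m) * e = f * \<phi> m * e"
    using phi_ad_pow[of m] ad_pow_corner(1)[OF assms, of "Suc k"] ad_pow_project(2)[of "Suc k"]
    by simp
  then have "(- 1) ^ Suc k * (f * \<phi> m * e) = f * \<phi> m * e"
    unfolding phi_sign by (simp only: sign_commute mult.assoc)
  then show ?thesis by (simp add: mult.assoc)
qed

lemma phi_off_diagonal:
  assumes "m \<in> corner e f"
  shows "e * \<phi> m * e = 0" "f * \<phi> m * f = 0"
proof -
  have "(- 1) ^ Suc k * \<phi> m = ad_pow e (Suc k) (\<phi> m)"
    using phi_ad_pow[of m] ad_pow_corner(1)[OF assms, of "Suc k"] phi_sign[of "Suc k" m] by metis
  then have eq: "\<phi> m = (- 1) ^ Suc k * ad_pow e (Suc k) (\<phi> m)" by (metis sign_sign)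
  show "e * \<phi> m * e = 0" "f * \<phi> m * f = 0"
    by (subst eq, simp only: sign_commute mult.assoc,
        simp only: mult.assoc[symmetric] ad_pow_project, simp)+
qed

lemma phi_diagonal:
  assumes "a \<in> corner e e"
  shows "e * \<phi> a * f = 0" "f * \<phi> a * e = 0"
proof -
  have "ad_pow e (Suc k) (\<phi> a) = 0"
    using phi_ad_pow[of a] ad_pow_diagonal[of a "Suc k"] assms by simp
  then show "e * \<phi> a * f = 0" "f * \<phi> a * e = 0"
    using ad_pow_project(1,2)[of "Suc k" "\<phi> a"] sign_cancel[of "Suc k" "e * \<phi> a * f" 0]
    by simp_all
qed

end

section \<open>Analysis of a splitting into three parts\<close>

text \<open>The additive form of the decomposition sought: \<open>d\<close> preserves the corners, \<open>\<delta>\<close> exchanges the two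
off-diagonal corners and \<open>\<gamma>\<close> is central. The assumption \<open>no_ideal_family\<close> imposes the closure condition
on both components, so that it is symmetric and follows from the absence of nonzero central ideals in
either diagonal corner.\<close>

locale lie_splitting = lie_laws e f k \<phi> for e f :: "'a::ring_1" and k \<phi> +
  fixes d \<delta> \<gamma> :: "'a \<Rightarrow> 'a"
  assumes split: "\<phi> x = d x + \<delta> x + \<gamma> x"
    and d_add: "d (x + y) = d x + d y" and \<delta>_add: "\<delta> (x + y) = \<delta> x + \<delta> y"
    and d_corner:
      "x \<in> corner e e \<Longrightarrow> d x \<in> corner e e" "x \<in> corner e f \<Longrightarrow> d x \<in> corner e f"
      "x \<in> corner f e \<Longrightarrow> d x \<in> corner f e" "x \<in> corner f f \<Longrightarrow> d x \<in> corner f f"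
    and \<delta>_corner:
      "x \<in> corner e f \<Longrightarrow> \<delta> x \<in> corner f e" "x \<in> corner f e \<Longrightarrow> \<delta> x \<in> corner e f"
    and \<delta>_diagonal:
      "x \<in> corner e e \<Longrightarrow> \<delta> x = 0" "x \<in> corner f f \<Longrightarrow> \<delta> x = 0"
    and \<gamma>_central: "\<gamma> x \<in> centre_of UNIV"
    and \<gamma>_off_diagonal: "x \<in> corner e f \<Longrightarrow> \<gamma> x = 0" "x \<in> corner f e \<Longrightarrow> \<gamma> x = 0"
    and no_ideal_family:
      "Z \<subseteq> centre_of UNIV \<Longrightarrow> \<forall>z\<in>Z. \<forall>a\<in>corner e e. \<exists>w\<in>Z. a * z = e * w \<Longrightarrow>
       \<forall>z\<in>Z. \<forall>b\<in>corner f f. \<exists>w\<in>Z. b * z = f * w \<Longrightarrow> Z \<subseteq> {0}"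
begin

lemma swap_splitting: "lie_splitting f e k \<phi> d \<delta> \<gamma>"
proof -
  interpret sw: lie_laws f e k \<phi> by (rule swap_lie_laws)
  show ?thesis
    by (unfold_locales; (rule no_ideal_family, assumption+)?)
      (simp_all only: split d_add \<delta>_add d_corner \<delta>_corner \<delta>_diagonal
         \<gamma>_central \<gamma>_off_diagonal)
qed

lemma d_zero [simp]: "d 0 = 0" using d_add[of 0 0] by simp
lemma \<delta>_zero [simp]: "\<delta> 0 = 0" using \<delta>_add[of 0 0] by simp
lemma d_minus: "d (- x) = - d x" using d_add[of x "- x"] by (simp add: minus_unique)
lemma d_diff: "d (x - y) = d x - d y" using d_add[of x "- y"] by (simp add: d_minus)

lemmas map_rules = d_corner \<delta>_corner \<delta>_diagonal

lemma commutator_phi: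
  "commutator (\<phi> x) y = commutator (d x) y + commutator (\<delta> x) y"
  "commutator x (\<phi> y) = commutator x (d y) + commutator x (\<delta> y)"
  by (simp_all add: split commutator_linear \<gamma>_central)

lemma \<delta>_sign:
  assumes "m \<in> corner e f"
  shows "(- 1) ^ k * \<delta> m = - \<delta> m"
proof -
  have "f * \<phi> m * e = \<delta> m"
    using assms by (simp add: split distrib_left distrib_right map_rules \<gamma>_off_diagonal corner_project)
  then show ?thesis using sign_f_component[OF assms] by (metis add.inverse_inverse)
qed

text \<open>Comparing corners in the identity for \<open>(x, y, e, \<dots>, e)\<close>: in \<open>eAf\<close> the signs on both sides agree,
whereas in \<open>fAe\<close> only the left-hand side carries \<open>(-1)^k\<close>, which \<open>\<delta>_sign\<close> converts into \<open>-1\<close>. This sign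
is why \<open>\<delta>\<close> reverses products.\<close>

lemma components_of_off_diagonal_commutator:
  assumes "commutator x y \<in> corner e f"
  shows "d (commutator x y) = e * (commutator (\<phi> x) y + commutator x (\<phi> y)) * f"
    and "\<delta> (commutator x y) = - (f * (commutator (\<phi> x) y + commutator x (\<phi> y)) * e)"
proof -
  let ?c = "commutator x y" and ?r = "commutator (\<phi> x) y + commutator x (\<phi> y)"
  have phi: "\<phi> ?c = d ?c + \<delta> ?c" using assms by (simp add: split \<gamma>_off_diagonal)
  have eq: "(- 1) ^ k * \<phi> ?c = ad_pow e k ?r"
    using phi_ad_pow_commutator[of x y] by (simp add: ad_pow_corner(1)[OF assms] phi_sign)
  have "e * ((- 1) ^ k * \<phi> ?c) * f = (- 1) ^ k * (e * ?r * f)"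
    unfolding eq by (rule ad_pow_project)
  then have "e * \<phi> ?c * f = e * ?r * f"
    by (simp only: sign_commute mult.assoc sign_cancel)
  then show "d ?c = e * ?r * f"
    using assms by (simp add: phi distrib_left distrib_right corner_project map_rules)
  have "f * ((- 1) ^ k * \<phi> ?c) * e = f * ?r * e"
    unfolding eq by (rule ad_pow_project)
  then have "(- 1) ^ k * (f * \<phi> ?c * e) = f * ?r * e"
    by (simp only: sign_commute mult.assoc)
  moreover have "f * \<phi> ?c * e = \<delta> ?c"
    using assms by (simp add: phi distrib_left distrib_right corner_project map_rules)
  ultimately show "\<delta> ?c = - (f * ?r * e)" using \<delta>_sign[OF assms] by (metis minus_minus)
qed

lemma left_action:
  assumes "a \<in> corner e e" "m \<in> corner e f"
  shows "d (a * m) = d a * m + a * d m" "\<delta> (a * m) = \<delta> m * a"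
proof -
  have c: "commutator a m = a * m" using assms by (simp add: commutator_def corner_mult_zero)
  then have "commutator a m \<in> corner e f" using assms by (simp add: corner_mult)
  note components_of_off_diagonal_commutator[OF this, unfolded c commutator_phi]
  then show "d (a * m) = d a * m + a * d m" "\<delta> (a * m) = \<delta> m * a"
    using assms
    by (simp_all add: commutator_def map_rules corner_rules corner_project distrib_left
        distrib_right left_diff_distrib right_diff_distrib)
qed

lemma right_action:
  assumes "m \<in> corner e f" "b \<in> corner f f"
  shows "d (m * b) = d m * b + m * d b" "\<delta> (m * b) = b * \<delta> m"
proof -
  have c: "commutator m b = m * b" using assms by (simp add: commutator_def corner_mult_zero)
  then have "commutator m b \<in> corner e f" using assms by (simp add: corner_mult)
  note components_of_off_diagonal_commutator[OF this, unfolded c commutator_phi]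
  then show "d (m * b) = d m * b + m * d b" "\<delta> (m * b) = b * \<delta> m"
    using assms
    by (simp_all add: commutator_def map_rules corner_rules corner_project distrib_left
        distrib_right left_diff_distrib right_diff_distrib)
qed

text \<open>Expanding \<open>d (a c m)\<close> in two ways by \<open>left_action\<close> shows that the defect annihilates \<open>eAf\<close> from the left;
\<open>right_action\<close> for the exchanged idempotents does the same on the other side.\<close>

lemma d_diagonal_mult:
  assumes "a \<in> corner e e" "c \<in> corner e e"
  shows "d (a * c) = d a * c + a * d c"
proof -
  interpret sw: lie_splitting f e k \<phi> d \<delta> \<gamma> by (rule swap_splitting)
  have "d (a * c) - (d a * c + a * d c) = 0"
  proof (rule faithful_e)
    show "d (a * c) - (d a * c + a * d c) \<in> corner e e"
      using assms by (simp add: map_rules corner_rules)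
    have "d (a * c) * m = (d a * c + a * d c) * m" if m: "m \<in> corner e f" for m
      using left_action(1)[of "a * c" m] left_action(1)[of a "c * m"] left_action(1)[of c m]
        assms m
      by (simp add: corner_mult mult.assoc distrib_left distrib_right)
    then show "\<forall>m\<in>corner e f. (d (a * c) - (d a * c + a * d c)) * m = 0"
      by (simp add: left_diff_distrib)
    have "m * d (a * c) = m * (d a * c + a * d c)" if m: "m \<in> corner f e" for m
      using sw.right_action(1)[of m "a * c"] sw.right_action(1)[of "m * a" c]
        sw.right_action(1)[of m a] assms m
      by (simp add: corner_mult mult.assoc[symmetric] distrib_left distrib_right)
    then show "\<forall>m\<in>corner f e. m * (d (a * c) - (d a * c + a * d c)) = 0"
      by (simp add: right_diff_distrib)
  qed
  then show ?thesis by simp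
qed

text \<open>The identity for \<open>(m, e, \<dots>, e, u)\<close>; the terms with \<open>\<delta>\<close> drop out because \<open>\<delta> m\<close> and \<open>u\<close> both lie in
\<open>fAe\<close>, and \<open>m\<close> and \<open>\<delta> u\<close> both in \<open>eAf\<close>. Thus \<open>\<gamma> [m, u]\<close> measures the failure of the product rule for \<open>d\<close>.\<close>

lemma bracket_off_diagonal:
  assumes "m \<in> corner e f" "u \<in> corner f e"
  shows "\<gamma> (commutator m u) =
    commutator (d m) u + commutator m (d u) - d (commutator m u)"
proof -
  have "\<delta> (commutator m u) = \<delta> (m * u) - \<delta> (u * m)"
    using \<delta>_add[of "m * u - u * m" "u * m"] by (simp add: commutator_def)
  then have \<delta>: "\<delta> (commutator m u) = 0" using assms by (simp add: map_rules corner_mult)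
  have "\<phi> ((- 1) ^ k * commutator m u) =
      commutator (ad_pow e k (\<phi> m)) u + (- 1) ^ k * commutator m (\<phi> u)"
    using phi_commutator_ad_pow[of m u] ad_pow_corner(1)[OF assms(1), of k]
    by (simp add: commutator_def algebra_simps sign_commute)
  also have "ad_pow e k (\<phi> m) = (- 1) ^ k * d m + \<delta> m"
    using assms(1) by (simp add: split \<gamma>_off_diagonal ad_pow_add ad_pow_corner map_rules)
  also have "commutator \<dots> u = (- 1) ^ k * commutator (d m) u"
    using assms by (simp add: commutator_def algebra_simps sign_commute map_rules corner_mult_zero)
  also have "commutator m (\<phi> u) = commutator m (d u)"
    unfolding commutator_phi using assms by (simp add: commutator_def map_rules corner_mult_zero)
  finally have "\<phi> (commutator m u) = commutator (d m) u + commutator m (d u)"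
    by (simp add: phi_sign distrib_left[symmetric])
  then show ?thesis using \<delta> by (simp add: split algebra_simps)
qed

text \<open>The \<open>e\<close>-component of \<open>\<gamma> [m, u]\<close> is \<open>d m u + m d u - d (m u)\<close>, which is left linear in \<open>m\<close> over \<open>eAe\<close>
because \<open>d\<close> satisfies the product rule for \<open>a m\<close> and for \<open>a (m u)\<close>; in the same way the \<open>f\<close>-component is
left linear in \<open>u\<close> over \<open>fAf\<close>. So these components are closed under multiplication.\<close>

lemma \<gamma>_bracket_zero:
  assumes "m \<in> corner e f" "u \<in> corner f e"
  shows "\<gamma> (commutator m u) = 0"
proof -
  interpret sw: lie_splitting f e k \<phi> d \<delta> \<gamma> by (rule swap_splitting)
  let ?Z = "{\<gamma> (commutator m u) |m u. m \<in> corner e f \<and> u \<in> corner f e}"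
  have "?Z \<subseteq> {0}"
  proof (rule no_ideal_family)
    show "?Z \<subseteq> centre_of UNIV" using \<gamma>_central by auto
    have e_part: "a * \<gamma> (commutator m u) = a * (d m * u + m * d u - d (m * u))"
      if "a \<in> corner e e" "m \<in> corner e f" "u \<in> corner f e" for a m u
    proof -
      have "a * (u * v) = 0" if "u \<in> corner f e" for u v
        using \<open>a \<in> corner e e\<close> that by (simp add: mult.assoc[symmetric] corner_mult_zero)
      moreover have "a * d (u * m) = 0"
        using that by (intro corner_mult_zero) (simp_all add: map_rules corner_mult)
      ultimately show ?thesis unfolding bracket_off_diagonal[OF that(2,3)] using that
        by (simp add: commutator_def d_diff right_diff_distrib distrib_left map_rules)
    qed
    have f_part: "b * \<gamma> (commutator m u) = b * (d (u * m) - d u * m - u * d m)"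
      if "b \<in> corner f f" "m \<in> corner e f" "u \<in> corner f e" for b m u
    proof -
      have "b * (m * v) = 0" if "m \<in> corner e f" for m v
        using \<open>b \<in> corner f f\<close> that by (simp add: mult.assoc[symmetric] corner_mult_zero)
      moreover have "b * d (m * u) = 0"
        using that by (intro corner_mult_zero) (simp_all add: map_rules corner_mult)
      ultimately show ?thesis unfolding bracket_off_diagonal[OF that(2,3)] using that
        by (simp add: commutator_def d_diff right_diff_distrib distrib_left map_rules)
    qed
    have e: "e \<in> corner e e" and f: "f \<in> corner f f" by (simp_all add: corner_iff idem idem_f)
    have "a * \<gamma> (commutator m u) = e * \<gamma> (commutator (a * m) u)"
      if "a \<in> corner e e" "m \<in> corner e f" "u \<in> corner f e" for a m u
    proof -
      have "e * \<gamma> (commutator (a * m) u) = d (a * m) * u + a * m * d u - d (a * (m * u))"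
        using that by (simp add: e_part[OF e] corner_mult mult.assoc)
          (subst corner_iff(1)[THEN iffD1, THEN conjunct1], simp_all add: map_rules corner_rules)
      also have "\<dots> = a * (d m * u + m * d u - d (m * u))"
        using that by (simp add: left_action d_diagonal_mult corner_mult algebra_simps)
      finally show ?thesis using that by (simp add: e_part)
    qed
    then show "\<forall>z\<in>?Z. \<forall>a\<in>corner e e. \<exists>w\<in>?Z. a * z = e * w" using corner_mult(2) by blast
    have "b * \<gamma> (commutator m u) = f * \<gamma> (commutator m (b * u))"
      if "b \<in> corner f f" "m \<in> corner e f" "u \<in> corner f e" for b m u
    proof -
      have "f * \<gamma> (commutator m (b * u)) = d (b * (u * m)) - d (b * u) * m - b * u * d m"
        using that by (simp add: f_part[OF f] corner_mult mult.assoc)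
          (subst corner_iff(4)[THEN iffD1, THEN conjunct1], simp_all add: map_rules corner_rules)
      also have "\<dots> = b * (d (u * m) - d u * m - u * d m)"
        using that by (simp add: sw.left_action sw.d_diagonal_mult corner_mult algebra_simps)
      finally show ?thesis using that by (simp add: f_part)
    qed
    then show "\<forall>z\<in>?Z. \<forall>b\<in>corner f f. \<exists>w\<in>?Z. b * z = f * w" using corner_mult(7) by blast
  qed
  then show ?thesis using assms by blast
qed

lemma d_off_diagonal_mult:
  assumes "m \<in> corner e f" "u \<in> corner f e"
  shows "d (m * u) = d m * u + m * d u"
proof -
  have 0: "commutator (d m) u + commutator m (d u) - d (commutator m u) = 0"
    using bracket_off_diagonal[OF assms] \<gamma>_bracket_zero[OF assms] by simp
  have "e * (commutator (d m) u + commutator m (d u) - d (commutator m u)) * e =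
      d m * u + m * d u - d (m * u)"
    using assms
    by (simp add: commutator_def d_diff right_diff_distrib left_diff_distrib distrib_left
        distrib_right corner_project corner_rules map_rules)
  then show ?thesis unfolding 0 by simp
qed

text \<open>The elements \<open>[\<delta> m, u]\<close> have \<open>f\<close>-component \<open>\<delta> m u\<close> and \<open>e\<close>-component \<open>- u \<delta> m\<close>. Since \<open>[m, u] = 0\<close>, the
identity for \<open>(m, e, \<dots>, e, u)\<close> makes them symmetric up to order, \<open>[\<delta> m, u] = [m, \<delta> u]\<close>, and the one for
\<open>(m, u, w, e, \<dots>, e)\<close> makes \<open>[\<delta> m, u] + [m, \<delta> u]\<close> commute with every off-diagonal \<open>w\<close>. Hence they are
central, by 2-torsion freeness. The rules \<open>\<delta> (m b) = b \<delta> m\<close> and the replacement of \<open>u\<close> by \<open>a u\<close> show that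
their components are closed under multiplication.\<close>

lemma \<delta>_kills_corner:
  assumes "m \<in> corner e f" "u \<in> corner e f"
  shows "\<delta> m * u = 0" "u * \<delta> m = 0"
proof -
  have sym: "commutator (\<delta> m) u = commutator m (\<delta> u)"
    if "m \<in> corner e f" "u \<in> corner e f" for m u
  proof -
    have "commutator m u = 0" using that by (simp add: commutator_def corner_mult_zero)
    then have "\<phi> (commutator (ad_pow e k m) u) = 0"
      using that by (simp add: ad_pow_corner commutator_def corner_rules sign_commute mult.assoc)
    then have "commutator (ad_pow e k (\<phi> m)) u + (- 1) ^ k * commutator m (\<phi> u) = 0"
      using phi_commutator_ad_pow[of m u] that
      by (simp add: ad_pow_corner commutator_def sign_commute mult.assoc right_diff_distrib)
    moreover have "ad_pow e k (\<phi> m) = (- 1) ^ k * d m + \<delta> m"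
      using that by (simp add: split \<gamma>_off_diagonal ad_pow_add ad_pow_corner map_rules)
    moreover have "commutator ((- 1) ^ k * d m + \<delta> m) u = commutator (\<delta> m) u"
      using that by (simp add: commutator_def algebra_simps sign_commute map_rules corner_mult_zero)
    moreover have "(- 1) ^ k * commutator m (\<phi> u) = commutator m ((- 1) ^ k * \<delta> u)"
      unfolding commutator_phi using that
      by (simp add: commutator_def map_rules corner_mult_zero sign_commute right_diff_distrib
          mult.assoc)
    ultimately show ?thesis using that by (simp add: \<delta>_sign commutator_linear)
  qed
  have central: "commutator (\<delta> m) u \<in> centre_of UNIV"
    if mu: "m \<in> corner e f" "u \<in> corner e f" for m u
  proof (cases "k = 0")
    case True
    \<comment> \<open>No third entry is available for ordinary Lie derivations, but then \<open>\<delta> = - \<delta>\<close> already.\<close>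
    then have "\<delta> m + \<delta> m = 0" using \<delta>_sign[OF mu(1)] by (simp add: eq_neg_iff_add_eq_0)
    then have "\<delta> m = 0" by (rule two_torsion_free)
    then show ?thesis by (simp add: central_zero)
  next
    case False
    let ?c = "commutator (\<delta> m) u"
    have mu0: "commutator m u = 0" using mu by (simp add: commutator_def corner_mult_zero)
    have dmu: "commutator (d m) u = 0" "commutator m (d u) = 0"
      using mu by (simp_all add: commutator_def corner_mult_zero map_rules)
    have twice: "ad_pow e (k - 1) (commutator ?c w + commutator ?c w) = 0" for w
      using phi_ad_pow_double_commutator[of m u w] False mu sym[OF mu]
      by (simp add: mu0 commutator_phi dmu commutator_linear)
    show ?thesis
    proof (rule central_if_commutes)
      show "e * ?c * f = 0" "f * ?c * e = 0"
        using mu by (simp_all add: commutator_def right_diff_distrib left_diff_distrib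
            corner_project corner_mult map_rules)
    next
      fix w assume w: "w \<in> corner e f"
      have cw: "commutator ?c w \<in> corner e f"
        using mu w by (simp add: commutator_def right_diff_distrib left_diff_distrib
            corner_rules map_rules mult.assoc)
      have "(- 1) ^ (k - 1) * (commutator ?c w + commutator ?c w) = 0"
        using twice[of w] by (simp only: ad_pow_corner(1)[OF corner_linear(2)[OF cw cw]])
      then have "commutator ?c w + commutator ?c w = 0"
        using sign_cancel[of "k - 1" "commutator ?c w + commutator ?c w" 0] by simp
      then show "commutator ?c w = 0" by (rule two_torsion_free)
    next
      fix w assume w: "w \<in> corner f e"
      have cw: "commutator ?c w \<in> corner f e"
        using mu w by (simp add: commutator_def right_diff_distrib left_diff_distrib
            corner_rules map_rules mult.assoc)
      have "commutator ?c w + commutator ?c w = 0"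
        using twice[of w] by (simp only: ad_pow_corner(2)[OF corner_linear(2)[OF cw cw]])
      then show "commutator ?c w = 0" by (rule two_torsion_free)
    qed
  qed
  let ?Z = "{commutator (\<delta> m) u |m u. m \<in> corner e f \<and> u \<in> corner e f}"
  have "?Z \<subseteq> {0}"
  proof (rule no_ideal_family)
    show "?Z \<subseteq> centre_of UNIV" using central by auto
    have "a * commutator (\<delta> m) u = e * commutator (\<delta> m) (a * u)"
      if "a \<in> corner e e" "m \<in> corner e f" "u \<in> corner e f" for a m u
    proof -
      have "a * (\<delta> m * u) = 0" "e * (\<delta> m * (a * u)) = 0"
        using that map_rules(5)[OF that(2)]
        by (simp_all add: mult.assoc[symmetric] corner_mult_zero corner_kill)
      moreover have "e * (a * u * \<delta> m) = a * (u * \<delta> m)"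
        using that by (simp add: corner_iff mult.assoc[symmetric])
      ultimately show ?thesis by (simp add: commutator_def right_diff_distrib)
    qed
    then show "\<forall>z\<in>?Z. \<forall>a\<in>corner e e. \<exists>w\<in>?Z. a * z = e * w" using corner_mult(2) by blast
    have "b * commutator (\<delta> m) u = f * commutator (\<delta> (m * b)) u"
      if "b \<in> corner f f" "m \<in> corner e f" "u \<in> corner e f" for b m u
    proof -
      have "b * (u * \<delta> m) = 0" "f * (u * \<delta> (m * b)) = 0"
        using that by (simp_all add: mult.assoc[symmetric] corner_mult_zero corner_kill)
      moreover have "f * (\<delta> (m * b) * u) = b * (\<delta> m * u)"
        using that by (simp add: right_action corner_iff mult.assoc[symmetric])
      ultimately show ?thesis by (simp add: commutator_def right_diff_distrib)
    qed
    then show "\<forall>z\<in>?Z. \<forall>b\<in>corner f f. \<exists>w\<in>?Z. b * z = f * w" using corner_mult(4) by blast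
  qed
  then have 0: "commutator (\<delta> m) u = 0" using assms by blast
  have "f * commutator (\<delta> m) u * f = \<delta> m * u" "e * commutator (\<delta> m) u * e = - (u * \<delta> m)"
    using assms by (simp_all add: commutator_def right_diff_distrib left_diff_distrib
        corner_project corner_mult map_rules)
  then show "\<delta> m * u = 0" "u * \<delta> m = 0" unfolding 0 by simp_all
qed

text \<open>The eight products whose first factor is in \<open>eAe\<close> or \<open>eAf\<close>; the other eight arise by exchanging \<open>e\<close> and \<open>f\<close>.\<close>

lemma derivation_on_corners:
  assumes "x \<in> corner e e \<union> corner e f"
    and "y \<in> corner e e \<union> corner e f \<union> corner f e \<union> corner f f"
  shows "d (x * y) = d x * y + x * d y" "\<delta> (x * y) = \<delta> y * x + y * \<delta> x"
  using assms
  by (auto simp: d_diagonal_mult left_action right_action d_off_diagonal_mult \<delta>_kills_corner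
      map_rules corner_rules)

lemma d_mult: "d (x * y) = d x * y + x * d y"
  and \<delta>_mult: "\<delta> (x * y) = \<delta> y * x + y * \<delta> x"
proof -
  interpret sw: lie_splitting f e k \<phi> d \<delta> \<gamma> by (rule swap_splitting)
  let ?C = "corner e e \<union> corner e f \<union> corner f e \<union> corner f f"
  have *: "d (x * y) = d x * y + x * d y \<and> \<delta> (x * y) = \<delta> y * x + y * \<delta> x"
    if "x \<in> ?C" "y \<in> ?C" for x y
  proof (cases "x \<in> corner e e \<union> corner e f")
    case True
    then show ?thesis using derivation_on_corners that by blast
  next
    case False
    then show ?thesis using sw.derivation_on_corners that by blast
  qed
  show "d (x * y) = d x * y + x * d y"
    by (rule biadditive_eq) (use * in \<open>auto simp: algebra_simps d_add\<close>)
  show "\<delta> (x * y) = \<delta> y * x + y * \<delta> x"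
    by (rule biadditive_eq) (use * in \<open>auto simp: algebra_simps \<delta>_add\<close>)
qed

text \<open>The largest ideal contained in \<open>eAf + fAe\<close>.\<close>

definition off_diagonal_core :: "'a set" where
  "off_diagonal_core = {c. \<forall>x y. e * (x * c * y) * e = 0 \<and> f * (x * c * y) * f = 0}"

lemma off_diagonal_core_commutator:
  assumes "c \<in> off_diagonal_core"
  shows "commutator c z \<in> off_diagonal_core" "commutator z c \<in> off_diagonal_core"
proof -
  have "e * (x * (c * z) * y) * e = 0 \<and> f * (x * (c * z) * y) * f = 0"
    "e * (x * (z * c) * y) * e = 0 \<and> f * (x * (z * c) * y) * f = 0" for x y
    using assms[unfolded off_diagonal_core_def, simplified, rule_format, of x "z * y"]
      assms[unfolded off_diagonal_core_def, simplified, rule_format, of "x * z" y]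
    by (simp_all add: mult.assoc)
  then show "commutator c z \<in> off_diagonal_core" "commutator z c \<in> off_diagonal_core"
    by (simp_all add: off_diagonal_core_def commutator_def right_diff_distrib left_diff_distrib)
qed

lemma off_diagonal_core_add:
  "c \<in> off_diagonal_core \<Longrightarrow> c' \<in> off_diagonal_core \<Longrightarrow> c + c' \<in> off_diagonal_core"
  by (simp add: off_diagonal_core_def distrib_left distrib_right)

lemma \<delta>_decomposition: "\<delta> x = \<delta> (e * x * f) + \<delta> (f * x * e)"
  by (subst (1) decomposition[of x]) (simp add: \<delta>_add map_rules)

text \<open>In \<open>x \<delta> z y\<close> a diagonal component can only arise by multiplying \<open>\<delta> (fAe)\<close> with \<open>fAe\<close>, or \<open>\<delta> (eAf)\<close> with
\<open>eAf\<close>, and these products vanish.\<close>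

lemma \<delta>_in_core: "\<delta> z \<in> off_diagonal_core"
proof -
  interpret sw: lie_splitting f e k \<phi> d \<delta> \<gamma> by (rule swap_splitting)
  have "e * (x * \<delta> z * y) * e = 0 \<and> f * (x * \<delta> z * y) * f = 0" for x y
  proof -
    define m n where "m = \<delta> (f * z * e)" and "n = \<delta> (e * z * f)"
    have mn: "m \<in> corner e f" "n \<in> corner f e" by (simp_all add: m_def n_def map_rules)
    have \<delta>z: "\<delta> z = e * m * f + f * n * e"
      using \<delta>_decomposition[of z] mn by (simp add: corner_project m_def n_def)
    have "e * (x * \<delta> z * y) * e = e * x * e * (m * (f * y * e)) + (e * x * f * n) * (e * y * e)"
      by (simp add: \<delta>z distrib_left distrib_right mult.assoc)
    also have "\<dots> = 0"
      by (simp add: m_def n_def \<delta>_kills_corner sw.\<delta>_kills_corner)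
    finally have 1: "e * (x * \<delta> z * y) * e = 0" .
    have "f * (x * \<delta> z * y) * f = (f * x * e * m) * (f * y * f) + f * x * f * (n * (e * y * f))"
      by (simp add: \<delta>z distrib_left distrib_right mult.assoc)
    also have "\<dots> = 0"
      by (simp add: m_def n_def \<delta>_kills_corner sw.\<delta>_kills_corner)
    finally show ?thesis using 1 by simp
  qed
  then show ?thesis by (simp add: off_diagonal_core_def)
qed

text \<open>Both sides of the identity for \<open>\<phi>\<close> are split into three parts. The parts for \<open>d\<close> cancel, since \<open>d\<close> is a
derivation, and the Leibniz sum for \<open>\<gamma>\<close> consists of commutators with central elements. What remains
expresses \<open>\<gamma> (p_comm n x)\<close> through elements of the core, which have no diagonal part.\<close>

lemma \<gamma>_p_comm:
  assumes "\<phi> (p_comm n x) = leibniz \<phi> n x" and "2 \<le> n"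
  shows "\<gamma> (p_comm n x) = 0"
proof -
  have "leibniz \<phi> n x = leibniz d n x + leibniz \<delta> n x + leibniz \<gamma> n x"
    using leibniz_add[of "\<lambda>x. d x + \<delta> x" \<gamma>] leibniz_add[of d \<delta>]
    by (simp add: split[abs_def])
  also have "leibniz d n x = d (p_comm n x)"
    by (intro leibniz_derivation d_diff d_mult)
  also have "leibniz \<gamma> n x = 0"
    by (intro leibniz_central \<gamma>_central assms)
  finally have eq: "\<gamma> (p_comm n x) = leibniz \<delta> n x - \<delta> (p_comm n x)"
    using assms(1) split[of "p_comm n x"] by (simp add: algebra_simps)
  have "leibniz \<delta> n x \<in> off_diagonal_core"
  proof (induction n x rule: p_comm.induct)
    case (1 x)
    show ?case by (simp add: off_diagonal_core_def)
  qed (simp_all add: \<delta>_in_core off_diagonal_core_add off_diagonal_core_commutator)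
  then have "f * leibniz \<delta> n x * f = 0" "f * \<delta> (p_comm n x) * f = 0"
    using \<delta>_in_core[of "p_comm n x"] unfolding off_diagonal_core_def
    by (force dest: spec[of _ 1])+
  then have "f * \<gamma> (p_comm n x) * f = 0" by (simp add: eq right_diff_distrib left_diff_distrib)
  then show ?thesis using \<gamma>_central by (rule central_zero_if_f_zero[rotated])
qed

end

section \<open>Existence of the splitting\<close>

text \<open>A central element is determined by its \<open>f\<close>-component, so the central elements extending
\<open>f \<phi>(a) f\<close> depend linearly on \<open>a\<close>.\<close>

lemma (in lie_laws) central_part:
  assumes "unital_algebra scale" and "linear_map scale \<phi>"
    and "\<And>a. a \<in> corner e e \<Longrightarrow> \<exists>z\<in>centre_of UNIV. f * \<phi> a * f = f * z * f"
  obtains \<rho> where "linear_map scale \<rho>" "\<And>x. \<rho> x \<in> centre_of UNIV"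
    "\<And>x. f * \<rho> x * f = f * \<phi> (e * x * e) * f"
proof -
  interpret unital_algebra scale by fact
  interpret phi: module_hom scale scale \<phi> by fact
  have "\<exists>z. z \<in> centre_of UNIV \<and> f * z * f = f * \<phi> (e * x * e) * f" for x
    using assms(3)[of "e * x * e"] by auto
  then obtain \<rho> where \<rho>: "\<And>x. \<rho> x \<in> centre_of UNIV" "\<And>x. f * \<rho> x * f = f * \<phi> (e * x * e) * f"
    by metis
  have unique: "z = w" if "z \<in> centre_of UNIV" "w \<in> centre_of UNIV" "f * z * f = f * w * f" for z w
    using central_zero_if_f_zero[OF central_diff[OF that(1,2)]] that(3)
    by (simp add: right_diff_distrib left_diff_distrib)
  have "\<rho> (x + y) = \<rho> x + \<rho> y" for x y
    by (rule unique) (simp_all add: \<rho> central_add distrib_left distrib_right phi_add)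
  moreover
  have scaled: "scale r (\<rho> x) \<in> centre_of UNIV" for r x
    using \<rho>(1)[of x] by (simp add: centre_of_def scale_mult_left scale_mult_right)
  have "\<rho> (scale r x) = scale r (\<rho> x)" for r x
    by (rule unique) (simp_all add: \<rho> scaled scale_mult_left scale_mult_right phi.scale)
  ultimately have "linear_map scale \<rho>"
    by (simp add: module_hom_iff module_axioms)
  with \<rho> show thesis by (rule that[rotated])
qed

text \<open>The value \<open>\<gamma> x\<close> is the sum of the central extensions obtained from the two diagonal components of \<open>x\<close>.
Subtracting it removes from the image of each diagonal corner the component in the opposite one.\<close>

lemma (in lie_laws) splitting_exists:
  assumes algebra: "unital_algebra scale" and linear: "linear_map scale \<phi>"
    and "\<And>a. a \<in> corner e e \<Longrightarrow> \<exists>z\<in>centre_of UNIV. f * \<phi> a * f = f * z * f"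
    and "\<And>b. b \<in> corner f f \<Longrightarrow> \<exists>z\<in>centre_of UNIV. e * \<phi> b * e = e * z * e"
    and no_family: "\<And>Z. Z \<subseteq> centre_of UNIV \<Longrightarrow> \<forall>z\<in>Z. \<forall>a\<in>corner e e. \<exists>w\<in>Z. a * z = e * w \<Longrightarrow>
       \<forall>z\<in>Z. \<forall>b\<in>corner f f. \<exists>w\<in>Z. b * z = f * w \<Longrightarrow> Z \<subseteq> {0}"
  obtains d \<delta> \<gamma> where "lie_splitting e f k \<phi> d \<delta> \<gamma>"
    "linear_map scale d" "linear_map scale \<delta>" "linear_map scale \<gamma>"
proof -
  interpret unital_algebra scale by (rule algebra)
  interpret phi: module_hom scale scale \<phi> by (rule linear)
  interpret sw: lie_laws f e k \<phi> by (rule swap_lie_laws)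
  obtain \<rho> where \<rho>: "linear_map scale \<rho>" "\<And>x. \<rho> x \<in> centre_of UNIV"
    "\<And>x. f * \<rho> x * f = f * \<phi> (e * x * e) * f"
    using central_part[OF assms(1,2,3)] by blast
  obtain \<sigma> where \<sigma>: "linear_map scale \<sigma>" "\<And>x. \<sigma> x \<in> centre_of UNIV"
    "\<And>x. e * \<sigma> x * e = e * \<phi> (f * x * f) * e"
    using sw.central_part[OF assms(1,2,4)] by blast
  interpret rho: module_hom scale scale \<rho> by (rule \<rho>)
  interpret sigma: module_hom scale scale \<sigma> by (rule \<sigma>)
  have \<rho>_zero: "\<rho> x = 0" if "e * x * e = 0" for x
    using central_zero_if_f_zero[OF \<rho>(2)[of x]] that by (simp add: \<rho>(3))
  have \<sigma>_zero: "\<sigma> x = 0" if "f * x * f = 0" for x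
    using sw.central_zero_if_f_zero[OF \<sigma>(2)[of x]] that by (simp add: \<sigma>(3))
  define \<delta> where "\<delta> x = f * \<phi> (e * x * f) * e + e * \<phi> (f * x * e) * f" for x
  define \<gamma> where "\<gamma> x = \<rho> x + \<sigma> x" for x
  define d where "d x = \<phi> x - \<delta> x - \<gamma> x" for x
  have lin: "linear_map scale \<delta>" "linear_map scale \<gamma>"
    by (simp_all add: module_hom_iff module_axioms \<delta>_def \<gamma>_def phi.scale phi.add rho.scale rho.add
        sigma.scale sigma.add scale_right_distrib scale_mult_left scale_mult_right
        distrib_left distrib_right)
  interpret delta: module_hom scale scale \<delta> by (rule lin)
  interpret gamma: module_hom scale scale \<gamma> by (rule lin)
  have lind: "linear_map scale d"
    by (simp add: module_hom_iff module_axioms d_def phi.scale phi.add delta.scale delta.add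
        gamma.scale gamma.add scale_right_diff_distrib)
  have d11: "d x \<in> corner e e" if x: "x \<in> corner e e" for x
  proof -
    have "d x = \<phi> x - \<rho> x"
      using x by (simp add: d_def \<delta>_def \<gamma>_def \<sigma>_zero corner_project)
    moreover have "\<phi> x - \<rho> x = e * (\<phi> x - \<rho> x) * e"
      using decomposition[of "\<phi> x - \<rho> x"] phi_diagonal[OF x] central_diagonal[OF \<rho>(2)[of x]] \<rho>(3)[of x] x
      by (simp add: right_diff_distrib left_diff_distrib corner_project)
    ultimately show ?thesis by (metis corner_components(1))
  qed
  have d22: "d x \<in> corner f f" if x: "x \<in> corner f f" for x
  proof -
    have "d x = \<phi> x - \<sigma> x"
      using x by (simp add: d_def \<delta>_def \<gamma>_def \<rho>_zero corner_project)
    moreover have "\<phi> x - \<sigma> x = f * (\<phi> x - \<sigma> x) * f"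
      using sw.decomposition[of "\<phi> x - \<sigma> x"] sw.phi_diagonal[OF x] sw.central_diagonal[OF \<sigma>(2)[of x]]
        \<sigma>(3)[of x] x
      by (simp add: right_diff_distrib left_diff_distrib corner_project)
    ultimately show ?thesis by (metis corner_components(4))
  qed
  have d12: "d x \<in> corner e f" if x: "x \<in> corner e f" for x
  proof -
    have "d x = \<phi> x - f * \<phi> x * e"
      using x by (simp add: d_def \<delta>_def \<gamma>_def \<rho>_zero \<sigma>_zero corner_project)
    also have "\<dots> = e * \<phi> x * f"
      using decomposition[of "\<phi> x"] phi_off_diagonal[OF x] by (simp add: diff_eq_eq)
    finally show ?thesis by simp
  qed
  have d21: "d x \<in> corner f e" if x: "x \<in> corner f e" for x
  proof -
    have "d x = \<phi> x - e * \<phi> x * f"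
      using x by (simp add: d_def \<delta>_def \<gamma>_def \<rho>_zero \<sigma>_zero corner_project)
    also have "\<dots> = f * \<phi> x * e"
      using decomposition[of "\<phi> x"] sw.phi_off_diagonal[OF x] by (simp add: diff_eq_eq add.commute)
    finally show ?thesis by simp
  qed
  interpret dd: module_hom scale scale d by (rule lind)
  have "lie_splitting e f k \<phi> d \<delta> \<gamma>"
  proof
    fix x y
    show "\<phi> x = d x + \<delta> x + \<gamma> x" by (simp add: d_def)
    show "\<delta> x \<in> corner f e" if "x \<in> corner e f" using that by (simp add: \<delta>_def corner_project)
    show "\<delta> x \<in> corner e f" if "x \<in> corner f e" using that by (simp add: \<delta>_def corner_project)
    show "\<delta> x = 0" if "x \<in> corner e e" using that by (simp add: \<delta>_def corner_project)
    show "\<delta> x = 0" if "x \<in> corner f f" using that by (simp add: \<delta>_def corner_project)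
    show "\<gamma> x \<in> centre_of UNIV" by (simp add: \<gamma>_def central_add \<rho> \<sigma>)
    show "\<gamma> x = 0" if "x \<in> corner e f" using that by (simp add: \<gamma>_def \<rho>_zero \<sigma>_zero corner_project)
    show "\<gamma> x = 0" if "x \<in> corner f e" using that by (simp add: \<gamma>_def \<rho>_zero \<sigma>_zero corner_project)
  qed (use d11 d12 d21 d22 in \<open>simp_all add: dd.add delta.add\<close>, rule no_family)
  with lind lin show thesis by (intro that)
qed

section \<open>Decomposition of Lie n-derivations\<close>

theorem corollary2p12:
  fixes scale :: "'r::comm_ring_1 \<Rightarrow> 'a::ring_1 \<Rightarrow> 'a"
    and e f :: 'a and n :: nat and \<phi> :: "'a \<Rightarrow> 'a"
  assumes "n \<ge> 2"
    and "unital_algebra scale"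
    and "nontrivial_idempotent e" and "f = 1 - e"
    and "torsion_free 2 TYPE('a)" and "torsion_free (n - 1) TYPE('a)"
    and "\<And>x. (\<lambda>m. (e * x * e) * m) ` corner e f = {0} \<Longrightarrow>
              (\<lambda>m. m * (e * x * e)) ` corner f e = {0} \<Longrightarrow> e * x * e = 0"
    and "\<And>x. (\<lambda>m. m * (f * x * f)) ` corner e f = {0} \<Longrightarrow>
              (\<lambda>m. (f * x * f) * m) ` corner f e = {0} \<Longrightarrow> f * x * f = 0"
    and "lie_n_derivation scale n \<phi>"
    and "(\<lambda>y. f * y * f) ` \<phi> ` corner e e \<subseteq> (\<lambda>z. f * z * f) ` centre_of UNIV"
    and "(\<lambda>y. e * y * e) ` \<phi> ` corner f f \<subseteq> (\<lambda>z. e * z * e) ` centre_of UNIV"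
    and "(\<nexists>I. central_ideal_of scale (corner e e) I \<and> I \<noteq> {0}) \<or>
         (\<nexists>I. central_ideal_of scale (corner f f) I \<and> I \<noteq> {0})"
  shows "\<exists>d \<delta> \<gamma>. \<phi> = (\<lambda>x. d x + \<delta> x + \<gamma> x) \<and>
           derivation scale d \<and>
           singular_jordan_derivation scale e \<delta> \<and> antiderivation scale \<delta> \<and>
           linear_map scale \<gamma> \<and> range \<gamma> \<subseteq> centre_of UNIV \<and>
           (\<forall>x. \<gamma> (p_comm n x) = 0)"
proof -
  obtain k where n: "n = Suc (Suc k)" using assms(1) by (metis Suc_le_D numeral_2_eq_2 Suc_le_mono)
  have torsion: "w = 0" if "of_nat (Suc k) * w = 0" for w :: 'a
    using assms(6) that unfolding torsion_free_def n by simp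
  have two: "w = 0" if "w + w = 0" for w :: 'a
  proof -
    have "of_nat 2 * w = 0" using that by (simp add: mult_2)
    then show ?thesis using assms(5) unfolding torsion_free_def by blast
  qed
  interpret alg: unital_algebra scale by fact
  interpret peirce e f
    using assms(3,4) by unfold_locales (simp_all add: nontrivial_idempotent_def)
  interpret faithful_peirce e f
  proof
    fix a assume a: "a \<in> corner e e" "\<forall>m\<in>corner e f. a * m = 0" "\<forall>m\<in>corner f e. m * a = 0"
    then have "e * a * e = a" by (simp add: corner_project)
    moreover have "(\<lambda>m. a * m) ` corner e f = {0}" "(\<lambda>m. m * a) ` corner f e = {0}"
      using a(2,3) corner_linear(1) by fastforce+
    ultimately show "a = 0" using assms(7)[of a] by simp
  next
    fix b assume b: "b \<in> corner f f" "\<forall>m\<in>corner f e. b * m = 0" "\<forall>m\<in>corner e f. m * b = 0"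
    then have "f * b * f = b" by (simp add: corner_project)
    moreover have "(\<lambda>m. b * m) ` corner f e = {0}" "(\<lambda>m. m * b) ` corner e f = {0}"
      using b(2,3) corner_linear(1) by fastforce+
    ultimately show "b = 0" using assms(8)[of b] by simp
  qed
  interpret sw: faithful_peirce f e by (rule swap_faithful)
  interpret phi: module_hom scale scale \<phi>
    using assms(9) by (simp add: lie_n_derivation_def)
  have phi_leibniz: "\<phi> (p_comm n x) = leibniz \<phi> n x" for x
    using assms(9) by (simp add: lie_n_derivation_def leibniz_eq_sum)
  \<comment> \<open>The inner derivation \<open>[_, u]\<close> maps \<open>e\<close> to the off-diagonal part of \<open>\<phi> e\<close>.\<close>
  define u where "u = e * \<phi> e * f - f * \<phi> e * e"
  define D where "D x = commutator x u" for x
  define \<psi> where "\<psi> x = \<phi> x - D x" for x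
  have D_mult: "D (x * y) = D x * y + x * D y" for x y
    by (simp add: D_def commutator_def algebra_simps)
  have D_linear: "linear_map scale D"
    by (simp add: module_hom_iff alg.module_axioms D_def commutator_def alg.scale_mult_left
        alg.scale_mult_right alg.scale_right_diff_distrib algebra_simps)
  interpret D: module_hom scale scale D by (rule D_linear)
  have \<psi>_linear: "linear_map scale \<psi>"
    by (simp add: module_hom_iff alg.module_axioms \<psi>_def phi.add phi.scale D.add D.scale
        alg.scale_right_diff_distrib)
  interpret psi: module_hom scale scale \<psi> by (rule \<psi>_linear)
  have \<psi>_leibniz: "\<psi> (p_comm n x) = leibniz \<psi> n x" for x
    using phi_leibniz leibniz_derivation[of D n x, OF D.diff D_mult] leibniz_diff[of \<phi> D n x]
    by (simp add: \<psi>_def[abs_def])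
  have \<psi>_central: "\<psi> e \<in> centre_of UNIV"
  proof (rule image_of_idempotent_central[OF _ psi.add _ _ torsion])
    show "\<psi> (p_comm (Suc (Suc k)) x) = leibniz \<psi> (Suc (Suc k)) x" for x
      using \<psi>_leibniz by (simp only: n)
    show "e * \<psi> e * f = 0" "f * \<psi> e * e = 0"
      by (simp_all add: \<psi>_def D_def u_def commutator_def right_diff_distrib left_diff_distrib
          distrib_left distrib_right mult.assoc idem_simps)
  qed
  note laws = lie_laws_if_central_image[OF \<psi>_leibniz[unfolded n] \<psi>_central]
  interpret lie_laws e f k \<psi>
    by unfold_locales (rule psi.add laws two; assumption)+
  have "f * D a * f = 0" if "a \<in> corner e e" for a
    using that by (simp add: D_def commutator_def right_diff_distrib left_diff_distrib
        corner_kill mult.assoc) (simp add: mult.assoc[symmetric] corner_kill)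
  then have \<psi>_e: "\<exists>z\<in>centre_of UNIV. f * \<psi> a * f = f * z * f" if "a \<in> corner e e" for a
    using assms(10) that by (fastforce simp: \<psi>_def right_diff_distrib left_diff_distrib)
  have "e * D b * e = 0" if "b \<in> corner f f" for b
    using that by (simp add: D_def commutator_def right_diff_distrib left_diff_distrib
        corner_kill mult.assoc) (simp add: mult.assoc[symmetric] corner_kill)
  then have \<psi>_f: "\<exists>z\<in>centre_of UNIV. e * \<psi> b * e = e * z * e" if "b \<in> corner f f" for b
    using assms(11) that by (fastforce simp: \<psi>_def right_diff_distrib left_diff_distrib)
  have no_family: "Z \<subseteq> {0}"
    if "Z \<subseteq> centre_of UNIV" "\<forall>z\<in>Z. \<forall>a\<in>corner e e. \<exists>w\<in>Z. a * z = e * w"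
      "\<forall>z\<in>Z. \<forall>b\<in>corner f f. \<exists>w\<in>Z. b * z = f * w" for Z
    using assms(12) no_central_family[OF assms(2) _ that(1,2)]
      sw.no_central_family[OF assms(2) _ that(1,3)] by blast
  obtain d \<delta> \<gamma> where split: "lie_splitting e f k \<psi> d \<delta> \<gamma>"
    and lin: "linear_map scale d" "linear_map scale \<delta>" "linear_map scale \<gamma>"
    using splitting_exists[OF assms(2) \<psi>_linear \<psi>_e \<psi>_f no_family] by blast
  interpret lie_splitting e f k \<psi> d \<delta> \<gamma> by (rule split)
  interpret dm: module_hom scale scale d by (rule lin)
  interpret \<delta>m: module_hom scale scale \<delta> by (rule lin)
  have "\<phi> = (\<lambda>x. (d x + D x) + \<delta> x + \<gamma> x)"
  proof
    fix x
    show "\<phi> x = (d x + D x) + \<delta> x + \<gamma> x"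
      using split[of x] by (simp add: \<psi>_def algebra_simps)
  qed
  moreover have "derivation scale (\<lambda>x. d x + D x)"
    by (simp add: derivation_def module_hom_iff alg.module_axioms dm.add dm.scale D.add D.scale
        alg.scale_right_distrib d_mult D_mult algebra_simps)
  moreover have anti: "antiderivation scale \<delta>"
    by (simp add: antiderivation_def lin \<delta>_mult)
  moreover have "singular_jordan_derivation scale e \<delta>"
  proof -
    have "jordan_derivation scale \<delta>"
      by (simp add: jordan_derivation_def jordan_product_def lin \<delta>m.add \<delta>_mult algebra_simps)
    moreover have "\<delta> ` corner e e = {0}" "\<delta> ` corner f f = {0}"
      using \<delta>_diagonal corner_linear(1) by fastforce+
    moreover have "\<delta> ` corner e f \<subseteq> corner f e" "\<delta> ` corner f e \<subseteq> corner e f"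
      using \<delta>_corner by auto
    ultimately show ?thesis
      by (simp add: singular_jordan_derivation_def complement[symmetric])
  qed
  moreover have "range \<gamma> \<subseteq> centre_of UNIV" using \<gamma>_central by auto
  moreover have "\<forall>x. \<gamma> (p_comm n x) = 0"
    using \<gamma>_p_comm \<psi>_leibniz assms(1) by blast
  ultimately show ?thesis
    using lin(3) by (intro exI[of _ "\<lambda>x. d x + D x"] exI[of _ \<delta>] exI[of _ \<gamma>] conjI)
qed

end
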